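(* Let $\phi\in L^2(\mathbb R)$ and suppose that $\{\phi^{\mathbf M}_{0,k}(t):k\in\mathbb Z\}$ is a Riesz basis of its closed linear span $V_0^{\mathbf M}\subset L^2(\mathbb R)$. Then $\{\tilde\phi^{\mathbf M}_{0,k}(t):k\in\mathbb Z\}$ is an orthonormal basis of $V_0^{\mathbf M}$, where $\tilde\phi\in L^2(\mathbb R)$ is given by $$\widehat{\tilde\phi}\left(\frac{\omega-p}{B}\right)=\frac{\widehat\phi\left(\frac{\omega-p}{B}\right)}{\left(\sum_{k\in\mathbb Z}\left|\widehat\phi\left(\frac{\omega-p}{B}+2k\pi\right)\right|^2\right)^{1/2}}\quad\text{for a.e. }\omega\in\mathbb R.$$
   Context: Fix real numbers $A,B,C,D,p,q$ with $AD-BC=1$ and $B\neq0$, and write $\mathbf M=(A,B,C,D:p,q)$. For $\phi\in L^2(\mathbb R)$ and $k\in\mathbb Z$, $$\phi^{\mathbf M}_{0,k}(t)=\phi(t-k)\exp\left\{-\frac{i}{2B}\left(At^2+Dp^2-Ak^2\right)\right\},$$ and $\tilde\phi^{\mathbf M}_{0,k}$ is defined by the same formula with $\tilde\phi$ in place of $\phi$. The Fourier transform is normalized as $\widehat\phi(\xi)=\int_{\mathbb R}\phi(t)e^{-i\xi t}\,dt$ (extended to $L^2(\mathbb R)$). *)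

theory Defs
  imports "HOL-Analysis.Analysis"
begin

text \<open>
  Elements of \<open>L\<^sup>2(\<real>)\<close> are represented by Borel functions that are square integrable with
  respect to Lebesgue measure; two representatives of the same element agree a.e.
\<close>

definition square_integrable :: "(real \<Rightarrow> complex) \<Rightarrow> bool" where
  "square_integrable f \<longleftrightarrow>
     f \<in> borel_measurable lborel \<and> integrable lborel (\<lambda>t. (cmod (f t))\<^sup>2)"

definition l2_inner :: "(real \<Rightarrow> complex) \<Rightarrow> (real \<Rightarrow> complex) \<Rightarrow> complex" where
  "l2_inner f g = (LINT t|lborel. f t * cnj (g t))"

text \<open>Meaningful for square integrable \<open>f\<close> only: the Bochner integral of a non-integrable
  function is \<open>0\<close>.\<close>

definition l2_norm :: "(real \<Rightarrow> complex) \<Rightarrow> real" where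
  "l2_norm f = sqrt (LINT t|lborel. (cmod (f t))\<^sup>2)"

definition l2_closed_span :: "('i \<Rightarrow> real \<Rightarrow> complex) \<Rightarrow> (real \<Rightarrow> complex) set" where
  "l2_closed_span v = {f. square_integrable f \<and>
     (\<forall>e>0. \<exists>S c. finite S \<and> l2_norm (\<lambda>t. f t - (\<Sum>k\<in>S. c k * v k t)) < e)}"

text \<open>Unconditional convergence in \<open>L\<^sup>2(\<real>)\<close>.\<close>

definition l2_has_sum :: "('i \<Rightarrow> real \<Rightarrow> complex) \<Rightarrow> (real \<Rightarrow> complex) \<Rightarrow> bool" where
  "l2_has_sum v f \<longleftrightarrow>
     (\<forall>k. square_integrable (v k)) \<and> square_integrable f \<and>
     ((\<lambda>S. l2_norm (\<lambda>t. f t - (\<Sum>k\<in>S. v k t))) \<longlongrightarrow> 0) (finite_subsets_at_top UNIV)"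

definition riesz_basis :: "('i \<Rightarrow> real \<Rightarrow> complex) \<Rightarrow> (real \<Rightarrow> complex) set \<Rightarrow> bool" where
  "riesz_basis v V \<longleftrightarrow>
     (\<forall>k. square_integrable (v k)) \<and> l2_closed_span v = V \<and>
     (\<exists>a b. 0 < a \<and> a \<le> b \<and>
       (\<forall>c :: 'i \<Rightarrow> complex. (\<lambda>k. (cmod (c k))\<^sup>2) summable_on UNIV \<longrightarrow>
          (\<exists>f. l2_has_sum (\<lambda>k t. c k * v k t) f \<and>
               a * (\<Sum>\<^sub>\<infinity>k. (cmod (c k))\<^sup>2) \<le> (l2_norm f)\<^sup>2 \<and>
               (l2_norm f)\<^sup>2 \<le> b * (\<Sum>\<^sub>\<infinity>k. (cmod (c k))\<^sup>2))))"

definition orthonormal_basis :: "('i \<Rightarrow> real \<Rightarrow> complex) \<Rightarrow> (real \<Rightarrow> complex) set \<Rightarrow> bool" where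
  "orthonormal_basis v V \<longleftrightarrow>
     (\<forall>k. square_integrable (v k)) \<and>
     (\<forall>j k. l2_inner (v j) (v k) = (if j = k then 1 else 0)) \<and>
     l2_closed_span v = V"

definition fourier_L1 :: "(real \<Rightarrow> complex) \<Rightarrow> real \<Rightarrow> complex" where
  "fourier_L1 f \<xi> = (LINT t|lborel. f t * exp (- \<i> * of_real \<xi> * of_real t))"

text \<open>
  The extension to \<open>L\<^sup>2(\<real>)\<close> by continuity from \<open>L\<^sup>1(\<real>) \<inter> L\<^sup>2(\<real>)\<close>.
  The transform is determined up to a.e. equality; \<open>fourier_L2\<close> selects a representative.
\<close>

definition has_fourier_L2 :: "(real \<Rightarrow> complex) \<Rightarrow> (real \<Rightarrow> complex) \<Rightarrow> bool" where
  "has_fourier_L2 f g \<longleftrightarrow>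
     square_integrable f \<and> square_integrable g \<and>
     (\<exists>F :: nat \<Rightarrow> real \<Rightarrow> complex.
        (\<forall>n. integrable lborel (F n) \<and> square_integrable (F n) \<and>
             square_integrable (fourier_L1 (F n))) \<and>
        (\<lambda>n. l2_norm (\<lambda>t. F n t - f t)) \<longlonglongrightarrow> 0 \<and>
        (\<lambda>n. l2_norm (\<lambda>\<xi>. fourier_L1 (F n) \<xi> - g \<xi>)) \<longlonglongrightarrow> 0)"

definition fourier_L2 :: "(real \<Rightarrow> complex) \<Rightarrow> real \<Rightarrow> complex" where
  "fourier_L2 f = (SOME g. has_fourier_L2 f g)"

text \<open>The family \<open>\<phi>\<^sub>0\<^sub>,\<^sub>k\<close> for the parameter matrix \<open>(A, B, C, D : p, q)\<close>; its members do not
  depend on \<open>C\<close> and \<open>q\<close>.\<close>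

definition chirp_translate ::
    "real \<Rightarrow> real \<Rightarrow> real \<Rightarrow> real \<Rightarrow> real \<Rightarrow> real \<Rightarrow> (real \<Rightarrow> complex) \<Rightarrow> int \<Rightarrow> real \<Rightarrow> complex" where
  "chirp_translate A B C D p q \<phi> k t =
     \<phi> (t - of_int k) *
     exp (- (\<i> / of_real (2 * B)) * of_real (A * t\<^sup>2 + D * p\<^sup>2 - A * (of_int k)\<^sup>2))"

end

theory Submission
  imports Defs "HOL-Probability.Probability"
begin

text \<open>
  Multiplication by the chirp \<open>exp (- \<i> (A t\<^sup>2 + D p\<^sup>2) / (2 B))\<close> is unitary, and the remaining factors
  \<open>exp (\<i> A k\<^sup>2 / (2 B))\<close> are unimodular constants. Hence the statement about chirp-modulated translates
  is equivalent to the one about the plain translates \<open>\<phi>(\<cdot> - k)\<close>.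

  Write \<open>g\<close> for the Fourier transform of \<open>\<phi>\<close> and \<open>G \<xi> = \<Sum>k. \<bar>g (\<xi> + 2 \<pi> k)\<bar>\<^sup>2\<close>. Translation by \<open>k\<close> becomes
  multiplication by \<open>exp (- \<i> k \<xi>)\<close>, so by Plancherel's theorem and by folding \<open>\<real>\<close> onto one period
  \<open>2 \<pi> \<parallel>\<Sum> c\<^sub>k \<phi>(\<cdot> - k)\<parallel>\<^sup>2\<close> is the integral of \<open>\<bar>P\<bar>\<^sup>2 G\<close> over a period, where
  \<open>P \<xi> = \<Sum> c\<^sub>k exp (- \<i> k \<xi>)\<close>
  (\<open>translates_norm\<close>). Everything takes place in the weighted space \<open>L\<^sup>2(G)\<close> on a period, where the
  trigonometric polynomials are dense for any integrable weight (\<open>trig_dense_weighted\<close>).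

  The lower Riesz bound forces \<open>G > 0\<close> almost everywhere: otherwise trigonometric polynomials that
  approximate the indicator of \<open>{G = 0}\<close> would give combinations of translates whose norms tend to \<open>0\<close>
  while their coefficients do not (\<open>periodization_pos_AE\<close>). If \<open>\<psi>\<close> has the transform \<open>g / sqrt G\<close>, its own
  periodization is therefore \<open>1\<close>, and the identity above reads \<open>\<parallel>\<Sum> c\<^sub>k \<psi>(\<cdot> - k)\<parallel>\<^sup>2 = \<Sum> \<bar>c\<^sub>k\<bar>\<^sup>2\<close>, which is
  orthonormality (\<open>normalized_translates_norm\<close>). The closed spans agree because \<open>1 / sqrt G\<close> is a limit of
  trigonometric polynomials in \<open>L\<^sup>2(G)\<close> and \<open>sqrt G\<close> is one in the unweighted space (\<open>translate_approx\<close>).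
  The first of these approximations also produces \<open>\<psi>\<close>, as a limit of combinations of translates of \<open>\<phi>\<close>
  (\<open>normalized_generator_exists\<close>).

  Plancherel's theorem itself is obtained by Gaussian regularization (\<open>Plancherel_L1\<close>), and the transform
  extends to \<open>L\<^sup>2\<close> by completeness (\<open>l2_complete\<close>).
\<close>

section \<open>The seminormed space of square integrable functions\<close>

lemma square_integrable_iff:
  "square_integrable f \<longleftrightarrow> f \<in> borel_measurable borel \<and>
     (\<integral>\<^sup>+t. ennreal ((cmod (f t))\<^sup>2) \<partial>lborel) < \<infinity>"
  unfolding square_integrable_def integrable_iff_bounded by auto

lemma square_integrable_measurable [measurable_dest]:
  "square_integrable f \<Longrightarrow> f \<in> borel_measurable borel"
  by (simp add: square_integrable_def)

lemma square_integrableD: "square_integrable f \<Longrightarrow> integrable lborel (\<lambda>t. (cmod (f t))\<^sup>2)"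
  by (simp add: square_integrable_def)

lemma l2_norm_nonneg [simp]: "0 \<le> l2_norm f"
  by (simp add: l2_norm_def)

lemma l2_norm_power2: "(l2_norm f)\<^sup>2 = (LINT t|lborel. (cmod (f t))\<^sup>2)"
  by (simp add: l2_norm_def)

lemma ennreal_l2_norm_power2:
  "square_integrable f \<Longrightarrow>
     ennreal ((l2_norm f)\<^sup>2) = (\<integral>\<^sup>+t. ennreal ((cmod (f t))\<^sup>2) \<partial>lborel)"
  unfolding l2_norm_power2 square_integrable_def by (rule nn_integral_eq_integral[symmetric]) auto

lemma l2_norm_eqI:
  assumes "square_integrable f" "0 \<le> a"
    and "(\<integral>\<^sup>+t. ennreal ((cmod (f t))\<^sup>2) \<partial>lborel) = ennreal a"
  shows "(l2_norm f)\<^sup>2 = a"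
  using assms ennreal_l2_norm_power2[OF assms(1)] by simp

lemma square_integrable_cong_AE:
  assumes "square_integrable f" "g \<in> borel_measurable borel"
    and "AE t in lborel. cmod (f t) = cmod (g t)"
  shows "square_integrable g"
proof -
  have "(\<integral>\<^sup>+t. ennreal ((cmod (f t))\<^sup>2) \<partial>lborel) = (\<integral>\<^sup>+t. ennreal ((cmod (g t))\<^sup>2) \<partial>lborel)"
    using assms(3) by (intro nn_integral_cong_AE) auto
  then show ?thesis using assms by (simp add: square_integrable_iff)
qed

lemma square_integrable_zero [simp]: "square_integrable (\<lambda>t. 0)"
  by (simp add: square_integrable_def)

lemma square_integrable_cmult [simp]:
  "square_integrable f \<Longrightarrow> square_integrable (\<lambda>t. c * f t)"
  by (auto simp: square_integrable_def norm_mult power_mult_distrib)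

lemma square_integrable_add [simp]:
  assumes "square_integrable f" "square_integrable g"
  shows "square_integrable (\<lambda>t. f t + g t)"
proof -
  note [measurable] = assms
  have "cmod (a + b)^2 \<le> 2 * (cmod a)\<^sup>2 + 2 * (cmod b)\<^sup>2" for a b
  proof -
    have "cmod (a + b)^2 \<le> (cmod a + cmod b)^2"
      by (intro power_mono norm_triangle_ineq) auto
    also have "\<dots> \<le> 2 * (cmod a)\<^sup>2 + 2 * (cmod b)\<^sup>2"
      using sum_squares_bound[of "cmod a" "cmod b"] by (simp add: power2_sum)
    finally show ?thesis .
  qed
  note bound = this
  have "integrable lborel (\<lambda>t. (cmod (f t + g t))\<^sup>2)"
  proof (rule Bochner_Integration.integrable_bound)
    show "integrable lborel (\<lambda>t. 2 * (cmod (f t))\<^sup>2 + 2 * (cmod (g t))\<^sup>2)"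
      using assms by (intro Bochner_Integration.integrable_add integrable_mult_right square_integrableD)
    show "AE t in lborel. norm ((cmod (f t + g t))\<^sup>2) \<le> norm (2 * (cmod (f t))\<^sup>2 + 2 * (cmod (g t))\<^sup>2)"
      using bound by simp
  qed measurable
  then show ?thesis using assms by (simp add: square_integrable_def)
qed

lemma square_integrable_uminus [simp]:
  "square_integrable f \<Longrightarrow> square_integrable (\<lambda>t. - f t)"
  using square_integrable_cmult[of f "-1"] by simp

lemma square_integrable_diff [simp]:
  "square_integrable f \<Longrightarrow> square_integrable g \<Longrightarrow> square_integrable (\<lambda>t. f t - g t)"
  using square_integrable_add[of f "\<lambda>t. - g t"] by simp

lemma square_integrable_sum [simp]:
  "(\<And>k. k \<in> S \<Longrightarrow> square_integrable (v k)) \<Longrightarrow> square_integrable (\<lambda>t. \<Sum>k\<in>S. v k t)"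
  by (induction S rule: infinite_finite_induct) auto

lemma l2_norm_cmult: "l2_norm (\<lambda>t. c * f t) = cmod c * l2_norm f"
  by (simp add: l2_norm_def norm_mult power_mult_distrib real_sqrt_mult)

lemma l2_norm_minus_commute: "l2_norm (\<lambda>t. f t - g t) = l2_norm (\<lambda>t. g t - f t)"
  by (simp add: l2_norm_def norm_minus_commute)

lemma square_integrable_shift:
  assumes "square_integrable f"
  shows "square_integrable (\<lambda>t. f (t + a))"
  using assms lborel_integrable_real_affine[of "\<lambda>t. (cmod (f t))\<^sup>2" 1 a]
  by (auto simp: square_integrable_def add.commute)

lemma l2_norm_shift: "l2_norm (\<lambda>t. f (t + a)) = l2_norm f"
  using lborel_integral_real_affine[of 1 "\<lambda>t. (cmod (f t))\<^sup>2" a]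
  by (simp add: l2_norm_def add.commute)

lemma ennreal_power_strict_mono:
  "x < (y::ennreal) \<Longrightarrow> x ^ 2 < y ^ 2"
  by (cases x; cases y) (auto simp: ennreal_power ennreal_less_iff power_strict_mono)

lemma nn_integral_mult_le_l2_norm:
  assumes "square_integrable f" "square_integrable g"
  shows "(\<integral>\<^sup>+t. ennreal (cmod (f t) * cmod (g t)) \<partial>lborel) \<le> ennreal (l2_norm f * l2_norm g)"
proof -
  note [measurable] = assms
  have "(\<integral>\<^sup>+t. ennreal (cmod (f t)) * ennreal (cmod (g t)) \<partial>lborel)\<^sup>2
      \<le> (\<integral>\<^sup>+t. (ennreal (cmod (f t)))\<^sup>2 \<partial>lborel) * (\<integral>\<^sup>+t. (ennreal (cmod (g t)))\<^sup>2 \<partial>lborel)"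
    by (rule Cauchy_Schwarz_nn_integral) auto
  also have "\<dots> = (ennreal (l2_norm f * l2_norm g))\<^sup>2"
    by (simp add: ennreal_power ennreal_l2_norm_power2[symmetric] assms
        flip: ennreal_mult power_mult_distrib)
  finally have "(\<integral>\<^sup>+t. ennreal (cmod (f t)) * ennreal (cmod (g t)) \<partial>lborel)
      \<le> ennreal (l2_norm f * l2_norm g)" (is "?I \<le> ?r")
    by (meson linorder_not_le ennreal_power_strict_mono)
  then show ?thesis by (simp add: ennreal_mult)
qed

lemma borel_measurable_cnj [measurable (raw)]:
  "f \<in> borel_measurable M \<Longrightarrow> (\<lambda>x. cnj (f x)) \<in> borel_measurable M"
  by (rule borel_measurable_continuous_on[where f=cnj]) (auto intro: continuous_intros)

lemma integrable_mult_cnj: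
  assumes "square_integrable f" "square_integrable g"
  shows "integrable lborel (\<lambda>t. f t * cnj (g t))"
proof -
  note [measurable] = assms
  show ?thesis
    using nn_integral_mult_le_l2_norm[OF assms]
    by (intro integrableI_bounded) (auto simp: norm_mult intro: le_less_trans)
qed

lemma Cauchy_Schwarz_l2:
  assumes "square_integrable f" "square_integrable g"
  shows "cmod (l2_inner f g) \<le> l2_norm f * l2_norm g"
proof -
  have "ennreal (cmod (l2_inner f g)) \<le> (\<integral>\<^sup>+t. ennreal (cmod (f t * cnj (g t))) \<partial>lborel)"
    unfolding l2_inner_def by (intro integral_norm_bound_ennreal integrable_mult_cnj assms)
  also have "\<dots> \<le> ennreal (l2_norm f * l2_norm g)"
    using nn_integral_mult_le_l2_norm[OF assms] by (simp add: norm_mult)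
  finally show ?thesis by simp
qed

lemma l2_norm_add_power2:
  assumes "square_integrable f" "square_integrable g"
  shows "(l2_norm (\<lambda>t. f t + g t))\<^sup>2 = (l2_norm f)\<^sup>2 + (l2_norm g)\<^sup>2 + 2 * Re (l2_inner f g)"
proof -
  have "(cmod (a + b))\<^sup>2 = (cmod a)\<^sup>2 + (cmod b)\<^sup>2 + 2 * Re (a * cnj b)" for a b
    unfolding cmod_power2 by (simp add: power2_eq_square algebra_simps)
  then have "(l2_norm (\<lambda>t. f t + g t))\<^sup>2
      = (LINT t|lborel. (cmod (f t))\<^sup>2 + (cmod (g t))\<^sup>2 + 2 * Re (f t * cnj (g t)))"
    by (simp only: l2_norm_power2)
  also have "\<dots> = (l2_norm f)\<^sup>2 + (l2_norm g)\<^sup>2 + 2 * Re (l2_inner f g)"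
    using assms integrable_mult_cnj[OF assms]
    by (simp add: l2_norm_power2 l2_inner_def square_integrable_def del: times_complex.sel)
  finally show ?thesis .
qed

lemma l2_norm_triangle:
  assumes "square_integrable f" "square_integrable g"
  shows "l2_norm (\<lambda>t. f t + g t) \<le> l2_norm f + l2_norm g"
proof -
  have "Re (l2_inner f g) \<le> l2_norm f * l2_norm g"
    using Cauchy_Schwarz_l2[OF assms] complex_Re_le_cmod order_trans by blast
  then have "(l2_norm (\<lambda>t. f t + g t))\<^sup>2 \<le> (l2_norm f + l2_norm g)\<^sup>2"
    by (simp add: l2_norm_add_power2[OF assms] power2_sum)
  then show ?thesis by (rule power2_le_imp_le) simp
qed

lemma l2_norm_triangle_diff:
  assumes "square_integrable f" "square_integrable g" "square_integrable h"
  shows "l2_norm (\<lambda>t. f t - h t) \<le> l2_norm (\<lambda>t. f t - g t) + l2_norm (\<lambda>t. g t - h t)"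
  using l2_norm_triangle[of "\<lambda>t. f t - g t" "\<lambda>t. g t - h t"] assms by simp

lemma abs_l2_norm_diff_le:
  assumes "square_integrable f" "square_integrable g"
  shows "\<bar>l2_norm f - l2_norm g\<bar> \<le> l2_norm (\<lambda>t. f t - g t)"
  using l2_norm_triangle[of "\<lambda>t. f t - g t" g] l2_norm_triangle[of "\<lambda>t. g t - f t" f] assms
  by (simp add: l2_norm_minus_commute[of g f] abs_le_iff)

lemma l2_norm_tendsto:
  assumes "\<And>n. square_integrable (F n)" "square_integrable f"
    and "(\<lambda>n. l2_norm (\<lambda>t. F n t - f t)) \<longlonglongrightarrow> 0"
  shows "(\<lambda>n. l2_norm (F n)) \<longlonglongrightarrow> l2_norm f"
proof (rule metric_tendsto_imp_tendsto[OF assms(3)])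
  show "\<forall>\<^sub>F n in sequentially. dist (l2_norm (F n)) (l2_norm f) \<le> dist (l2_norm (\<lambda>t. F n t - f t)) 0"
    using abs_l2_norm_diff_le[OF assms(1,2)] by (simp add: dist_real_def)
qed

lemma l2_norm_sum_le:
  assumes "\<And>k. k \<in> S \<Longrightarrow> square_integrable (v k)"
  shows "l2_norm (\<lambda>t. \<Sum>k\<in>S. v k t) \<le> (\<Sum>k\<in>S. l2_norm (v k))"
  using assms
proof (induction S rule: infinite_finite_induct)
  case (insert x S)
  have "l2_norm (\<lambda>t. v x t + (\<Sum>k\<in>S. v k t)) \<le> l2_norm (v x) + l2_norm (\<lambda>t. \<Sum>k\<in>S. v k t)"
    using insert by (intro l2_norm_triangle) auto
  with insert show ?case by fastforce
qed (simp_all add: l2_norm_def)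

lemma l2_norm_eq_0_AE:
  assumes "square_integrable f" "l2_norm f = 0"
  shows "AE t in lborel. f t = 0"
proof -
  note [measurable] = assms(1)
  have "(\<integral>\<^sup>+t. ennreal ((cmod (f t))\<^sup>2) \<partial>lborel) = 0"
    using ennreal_l2_norm_power2[OF assms(1)] assms(2) by simp
  then show ?thesis by (simp add: nn_integral_0_iff_AE)
qed

text \<open>Polarization: the norms of \<open>f + g\<close> and \<open>f + \<i> g\<close> determine the real and the imaginary part of the
  inner product.\<close>

lemma l2_inner_eq_0_if_Pythagoras:
  assumes f: "square_integrable f" and g: "square_integrable g"
    and "l2_norm f = 1" "l2_norm g = 1"
    and "\<And>c. cmod c = 1 \<Longrightarrow> (l2_norm (\<lambda>t. f t + c * g t))\<^sup>2 = 2"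
  shows "l2_inner f g = 0"
proof -
  have *: "Re (cnj c * l2_inner f g) = 0" if "cmod c = 1" for c
  proof -
    have "l2_inner f (\<lambda>t. c * g t) = cnj c * l2_inner f g"
      by (simp add: l2_inner_def mult.left_commute)
    then show ?thesis
      using l2_norm_add_power2[of f "\<lambda>t. c * g t"] assms that by (simp add: l2_norm_cmult)
  qed
  from *[of 1] *[of \<i>] show ?thesis by (simp add: complex_eq_iff)
qed

lemma l2_inner_self: "l2_inner f f = of_real ((l2_norm f)\<^sup>2)"
proof -
  have "l2_inner f f = (LINT t|lborel. complex_of_real ((cmod (f t))\<^sup>2))"
    unfolding l2_inner_def
    by (intro arg_cong[where f="integral\<^sup>L lborel"] ext) (simp add: complex_norm_square[symmetric])
  also have "\<dots> = of_real ((l2_norm f)\<^sup>2)"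
    unfolding l2_norm_power2 by (rule integral_complex_of_real)
  finally show ?thesis .
qed

text \<open>Riesz--Fischer. A subsequence with summable increments converges a.e.: against the
  square integrable weight \<open>w\<close> the increments are summable in \<open>L\<^sup>1\<close>, hence almost everywhere.
  Fatou's lemma then bounds the distance to the limit.\<close>

lemma l2_complete:
  assumes F: "\<And>n. square_integrable (F n)"
    and Cauchy: "\<And>e. e > 0 \<Longrightarrow> \<exists>N. \<forall>m\<ge>N. \<forall>n\<ge>N. l2_norm (\<lambda>t. F m t - F n t) < e"
  obtains f where "square_integrable f" "(\<lambda>n. l2_norm (\<lambda>t. F n t - f t)) \<longlonglongrightarrow> 0"
proof -
  note [measurable] = F
  have "\<forall>k. \<exists>N. \<forall>m\<ge>N. \<forall>n\<ge>N. l2_norm (\<lambda>t. F m t - F n t) < (1/2) ^ k"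
    using Cauchy by simp
  then obtain N where N: "\<And>k m n. m \<ge> N k \<Longrightarrow> n \<ge> N k \<Longrightarrow> l2_norm (\<lambda>t. F m t - F n t) < (1/2) ^ k"
    by metis
  define r where "r k = k + (\<Sum>i\<le>k. N i)" for k
  have rN: "N k \<le> r k" "k \<le> r k" for k
    using member_le_sum[of k "{..k}" N] by (auto simp: r_def)
  have rN': "N k \<le> r (Suc k)" for k
    using rN(1)[of k] by (simp add: r_def)
  define w :: "real \<Rightarrow> complex" where "w t = of_real (sqrt (std_normal_density t))" for t
  have w: "square_integrable w"
    unfolding square_integrable_def w_def
    by (auto simp: norm_power power2_eq_square[symmetric] normal_density_nonneg)
  define u where "u k t = F (r (Suc k)) t - F (r k) t" for k t
  have u: "square_integrable (u k)" for k
    unfolding u_def using F by simp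
  note [measurable] = u w
  have "(\<integral>\<^sup>+t. (\<Sum>k. ennreal (cmod (u k t) * cmod (w t))) \<partial>lborel)
      = (\<Sum>k. \<integral>\<^sup>+t. ennreal (cmod (u k t) * cmod (w t)) \<partial>lborel)"
    by (rule nn_integral_suminf) auto
  also have "\<dots> \<le> (\<Sum>k. ennreal ((1/2) ^ k * l2_norm w))"
  proof (intro suminf_le allI)
    fix k
    have "(\<integral>\<^sup>+t. ennreal (cmod (u k t) * cmod (w t)) \<partial>lborel) \<le> ennreal (l2_norm (u k) * l2_norm w)"
      by (rule nn_integral_mult_le_l2_norm[OF u w])
    also have "\<dots> \<le> ennreal ((1/2) ^ k * l2_norm w)"
      using N[OF rN' rN(1), of k] unfolding u_def by (intro ennreal_leI mult_right_mono) auto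
    finally show "(\<integral>\<^sup>+t. ennreal (cmod (u k t) * cmod (w t)) \<partial>lborel) \<le> ennreal ((1/2) ^ k * l2_norm w)" .
  qed auto
  also have "\<dots> = ennreal (\<Sum>k. (1/2) ^ k * l2_norm w)"
    by (intro suminf_ennreal2) (auto intro: summable_mult2)
  finally have "(\<integral>\<^sup>+t. (\<Sum>k. ennreal (cmod (u k t) * cmod (w t))) \<partial>lborel) \<noteq> \<infinity>"
    by (metis ennreal_neq_top infinity_ennreal_def neq_top_trans)
  then have "AE t in lborel. (\<Sum>k. ennreal (cmod (u k t) * cmod (w t))) \<noteq> \<infinity>"
    by (intro nn_integral_PInf_AE) auto
  then have lim: "AE t in lborel. convergent (\<lambda>k. F (r k) t)"
  proof eventually_elim
    fix t assume "(\<Sum>k. ennreal (cmod (u k t) * cmod (w t))) \<noteq> \<infinity>"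
    then have "summable (\<lambda>k. cmod (u k t) * cmod (w t))"
      by (intro summable_suminf_not_top) auto
    moreover have "cmod (w t) \<noteq> 0"
      using normal_density_pos[of 1 0 t] by (simp add: w_def)
    ultimately have "summable (\<lambda>k. cmod (u k t))"
      using summable_mult2[of "\<lambda>k. cmod (u k t) * cmod (w t)" "inverse (cmod (w t))"]
      by (simp add: mult.assoc)
    then have "summable (\<lambda>k. u k t)"
      by (rule summable_norm_cancel)
    then have "convergent (\<lambda>n. \<Sum>k<n. u k t)"
      by (simp add: summable_iff_convergent)
    then have "convergent (\<lambda>n. (\<Sum>k<n. u k t) + F (r 0) t)"
      by (intro convergent_add convergent_const)
    then show "convergent (\<lambda>k. F (r k) t)"
      unfolding u_def sum_lessThan_telescope[where f="\<lambda>k. F (r k) t"] by simp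
  qed
  define f where "f t = lim (\<lambda>k. F (r k) t)" for t
  have [measurable]: "f \<in> borel_measurable borel"
    unfolding f_def by (rule borel_measurable_lim_metric) simp
  have fatou: "(\<integral>\<^sup>+t. ennreal ((cmod (F n t - f t))\<^sup>2) \<partial>lborel) \<le> ennreal (e\<^sup>2)"
    if "e > 0" and "\<And>m. m \<ge> M \<Longrightarrow> l2_norm (\<lambda>t. F n t - F m t) < e" for n e M
  proof -
    have "(\<integral>\<^sup>+t. ennreal ((cmod (F n t - f t))\<^sup>2) \<partial>lborel)
        = (\<integral>\<^sup>+t. liminf (\<lambda>k. ennreal ((cmod (F n t - F (r k) t))\<^sup>2)) \<partial>lborel)"
      using lim
    proof (intro nn_integral_cong_AE, eventually_elim)
      fix t assume "convergent (\<lambda>k. F (r k) t)"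
      then have "(\<lambda>k. F (r k) t) \<longlonglongrightarrow> f t"
        unfolding f_def by (simp add: convergent_LIMSEQ_iff)
      then have "(\<lambda>k. ennreal ((cmod (F n t - F (r k) t))\<^sup>2)) \<longlonglongrightarrow> ennreal ((cmod (F n t - f t))\<^sup>2)"
        by (intro tendsto_ennrealI tendsto_intros)
      then show "ennreal ((cmod (F n t - f t))\<^sup>2) = liminf (\<lambda>k. ennreal ((cmod (F n t - F (r k) t))\<^sup>2))"
        by (intro lim_imp_Liminf[symmetric] trivial_limit_sequentially)
    qed
    also have "\<dots> \<le> liminf (\<lambda>k. \<integral>\<^sup>+t. ennreal ((cmod (F n t - F (r k) t))\<^sup>2) \<partial>lborel)"
      by (intro nn_integral_liminf) auto
    also have "\<dots> \<le> ennreal (e\<^sup>2)"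
    proof (rule Liminf_le)
      show "\<forall>\<^sub>F k in sequentially. (\<integral>\<^sup>+t. ennreal ((cmod (F n t - F (r k) t))\<^sup>2) \<partial>lborel) \<le> ennreal (e\<^sup>2)"
      proof (rule eventually_sequentiallyI[of M])
        fix k assume "M \<le> k"
        then have "l2_norm (\<lambda>t. F n t - F (r k) t) < e"
          using that(2)[of "r k"] rN(2)[of k] by simp
        then have "(l2_norm (\<lambda>t. F n t - F (r k) t))\<^sup>2 \<le> e\<^sup>2"
          by (intro power_mono) auto
        then show "(\<integral>\<^sup>+t. ennreal ((cmod (F n t - F (r k) t))\<^sup>2) \<partial>lborel) \<le> ennreal (e\<^sup>2)"
          using F by (simp flip: ennreal_l2_norm_power2)
      qed
    qed simp
    finally show ?thesis .
  qed
  obtain M where M: "\<And>m n. m \<ge> M \<Longrightarrow> n \<ge> M \<Longrightarrow> l2_norm (\<lambda>t. F m t - F n t) < 1"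
    using Cauchy[of 1] by auto
  have "square_integrable (\<lambda>t. F M t - f t)"
    using fatou[of 1 M M] M by (auto simp: square_integrable_iff intro: le_less_trans)
  from square_integrable_diff[OF F[of M] this] have f: "square_integrable f" by simp
  moreover have "(\<lambda>n. l2_norm (\<lambda>t. F n t - f t)) \<longlonglongrightarrow> 0"
  proof (rule LIMSEQ_I)
    fix e :: real assume "e > 0"
    then obtain N where N: "\<And>m n. m \<ge> N \<Longrightarrow> n \<ge> N \<Longrightarrow> l2_norm (\<lambda>t. F m t - F n t) < e/2"
      using Cauchy[of "e/2"] by auto
    have "l2_norm (\<lambda>t. F n t - f t) \<le> e/2" if "n \<ge> N" for n
    proof -
      have "ennreal ((l2_norm (\<lambda>t. F n t - f t))\<^sup>2) \<le> ennreal ((e/2)\<^sup>2)"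
        using fatou[of "e/2" N n] N that \<open>e > 0\<close> F f by (simp add: ennreal_l2_norm_power2)
      then have "(l2_norm (\<lambda>t. F n t - f t))\<^sup>2 \<le> (e/2)\<^sup>2"
        by (subst (asm) ennreal_le_iff) simp_all
      then show ?thesis
        by (rule power2_le_imp_le) (use \<open>e > 0\<close> in simp)
    qed
    then show "\<exists>N. \<forall>n\<ge>N. norm (l2_norm (\<lambda>t. F n t - f t) - 0) < e"
      using \<open>e > 0\<close> by (intro exI[of _ N]) (fastforce intro: le_less_trans)
  qed
  ultimately show thesis by (rule that)
qed

section \<open>Approximation by continuous functions and continuity of translation\<close>

text \<open>Measurable functions are a.e. limits of continuous ones; for a bounded function the continuous
  functions can be given the same bound, which is what makes dominated convergence applicable.\<close>

lemma bounded_measurable_AE_limit_continuous: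
  fixes f :: "real \<Rightarrow> complex"
  assumes [measurable]: "f \<in> borel_measurable borel" and M: "\<And>x. cmod (f x) \<le> M"
  obtains h where "\<And>n::nat. continuous_on UNIV (h n)" "\<And>n x. cmod (h n x) \<le> M"
    "AE x in lborel. (\<lambda>n. h n x) \<longlonglongrightarrow> f x"
proof -
  have "f measurable_on UNIV"
    by (rule lebesgue_measurable_imp_measurable_on) (auto intro: measurable_completion)
  then obtain N g where N: "negligible N" and g: "\<And>n. continuous_on UNIV (g n)"
    and lim: "\<And>x. x \<notin> N \<Longrightarrow> (\<lambda>n. g n x) \<longlonglongrightarrow> f x"
    by (auto simp: measurable_on_def)
  \<comment> \<open>Projecting onto the disc of radius \<open>M\<close> keeps continuity and the limit.\<close>
  define c where "c = closest_point (cball (0::complex) M)"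
  have "0 \<le> M"
    using M[of 0] norm_ge_zero order_trans by blast
  then have ne: "cball (0::complex) M \<noteq> {}" by simp
  have c: "continuous_on UNIV c"
    unfolding c_def using ne by (intro continuous_on_closest_point) auto
  have "c z \<in> cball 0 M" for z
    unfolding c_def using ne by (intro closest_point_in_set) auto
  moreover have "c (f x) = f x" for x
    unfolding c_def using M[of x] by (intro closest_point_self) auto
  moreover have "AE x in lborel. x \<notin> N"
  proof -
    have "N \<in> null_sets (completion lborel)"
      using N by (simp add: negligible_iff_null_sets)
    then show ?thesis
      using AE_not_in AE_completion_iff by blast
  qed
  moreover have "(\<lambda>n. c (g n x)) \<longlonglongrightarrow> c (f x)" if "x \<notin> N" for x
    using continuous_on_tendsto_compose[OF c lim[OF that]] by simp
  ultimately show thesis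
    using continuous_on_compose2[OF c g]
    by (intro that[of "\<lambda>n x. c (g n x)"]) (auto elim!: eventually_mono)
qed

text \<open>The limit inherits the bound \<open>w\<close>, so that \<open>4 w\<^sup>2\<close> dominates the squared differences.\<close>

lemma l2_dominated_convergence:
  assumes [measurable]: "\<And>n. s n \<in> borel_measurable borel" "f \<in> borel_measurable borel"
    and w: "integrable lborel (\<lambda>t. (w t :: real)\<^sup>2)"
    and bound: "\<And>n. AE t in lborel. cmod (s n t) \<le> w t"
    and lim: "AE t in lborel. (\<lambda>n. s n t) \<longlonglongrightarrow> f t"
  shows "(\<lambda>n. l2_norm (\<lambda>t. s n t - f t)) \<longlonglongrightarrow> 0"
proof -
  have "AE t in lborel. \<forall>n. cmod (s n t) \<le> w t"
    using bound by (simp add: AE_all_countable)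
  with lim have f: "AE t in lborel. cmod (f t) \<le> w t"
    by eventually_elim (rule LIMSEQ_le_const2[OF tendsto_norm], auto)
  have "(\<lambda>n. LINT t|lborel. (cmod (s n t - f t))\<^sup>2) \<longlonglongrightarrow> (LINT (t::real)|lborel. (0::real))"
  proof (rule integral_dominated_convergence)
    show "integrable lborel (\<lambda>t. 4 * (w t)\<^sup>2)"
      using w by simp
    show "AE t in lborel. (\<lambda>n. (cmod (s n t - f t))\<^sup>2) \<longlonglongrightarrow> 0"
      using lim
    proof eventually_elim
      fix t assume "(\<lambda>n. s n t) \<longlonglongrightarrow> f t"
      then have "(\<lambda>n. (cmod (s n t - f t))\<^sup>2) \<longlonglongrightarrow> (cmod (f t - f t))\<^sup>2"
        by (intro tendsto_intros)
      then show "(\<lambda>n. (cmod (s n t - f t))\<^sup>2) \<longlonglongrightarrow> 0" by simp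
    qed
    show "AE t in lborel. norm ((cmod (s n t - f t))\<^sup>2) \<le> 4 * (w t)\<^sup>2" for n
      using bound[of n] f
    proof eventually_elim
      fix t assume "cmod (s n t) \<le> w t" "cmod (f t) \<le> w t"
      then have "cmod (s n t - f t) \<le> 2 * w t"
        using norm_triangle_ineq4[of "s n t" "f t"] by simp
      then have "(cmod (s n t - f t))\<^sup>2 \<le> (2 * w t)\<^sup>2"
        by (intro power_mono) auto
      then show "norm ((cmod (s n t - f t))\<^sup>2) \<le> 4 * (w t)\<^sup>2"
        by (simp add: power_mult_distrib)
    qed
  qed measurable
  then have "(\<lambda>n. sqrt (LINT t|lborel. (cmod (s n t - f t))\<^sup>2)) \<longlonglongrightarrow> sqrt 0"
    by (intro tendsto_intros) simp
  then show ?thesis by (simp add: l2_norm_def)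
qed

lemma l2_truncation_tendsto:
  assumes F: "square_integrable F"
  shows "(\<lambda>n. l2_norm (\<lambda>t. F t * indicator {t. \<bar>t\<bar> \<le> real n \<and> cmod (F t) \<le> real n} t - F t)) \<longlonglongrightarrow> 0"
proof -
  note [measurable] = F
  show ?thesis
  proof (rule l2_dominated_convergence)
    show "integrable lborel (\<lambda>t. (cmod (F t))\<^sup>2)"
      using F by (rule square_integrableD)
    show "AE t in lborel. (\<lambda>n. F t * indicator {t. \<bar>t\<bar> \<le> real n \<and> cmod (F t) \<le> real n} t) \<longlonglongrightarrow> F t"
    proof (intro AE_I2 tendsto_eventually)
      fix t
      obtain n0 where "max \<bar>t\<bar> (cmod (F t)) \<le> real n0"
        using real_arch_simple by blast
      then show "\<forall>\<^sub>F n in sequentially. F t * indicator {t. \<bar>t\<bar> \<le> real n \<and> cmod (F t) \<le> real n} t = F t"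
        by (intro eventually_sequentiallyI[of n0]) (auto simp: indicator_def)
    qed
  qed (auto simp: indicator_def)
qed

lemma integrable_indicator_Icc_power2:
  "integrable lborel (\<lambda>t. (c * indicator {a..b::real} t :: real)\<^sup>2)"
proof -
  have "(c * indicator {a..b} t)\<^sup>2 = c\<^sup>2 * indicator {a..b} t" for t
    by (auto simp: indicator_def)
  moreover have "integrable lborel (\<lambda>t. c\<^sup>2 * indicator {a..b} t)"
    by (intro integrable_mult_right integrable_real_indicator) (auto simp: emeasure_lborel_Icc_eq)
  ultimately show ?thesis by simp
qed

text \<open>The function is truncated in height and in support, the truncation is replaced by a continuous
  function with the same bound, and a continuous cutoff restores the compact support.\<close>

lemma l2_continuous_approx:
  assumes F: "square_integrable F" and "e > 0"
  obtains H M R where "continuous_on UNIV H" "\<And>t. cmod (H t) \<le> M"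
    "\<And>t. \<bar>t\<bar> > R \<Longrightarrow> H t = 0" "square_integrable H" "l2_norm (\<lambda>t. H t - F t) < e"
proof -
  note [measurable] = F
  define T where "T n t = F t * indicator {t. \<bar>t\<bar> \<le> real n \<and> cmod (F t) \<le> real n} t" for n t
  have "\<forall>\<^sub>F n in sequentially. l2_norm (\<lambda>t. T n t - F t) < e/2"
    using order_tendstoD(2)[OF l2_truncation_tendsto[OF F], of "e/2"] \<open>e > 0\<close> by (simp add: T_def)
  then obtain n where n: "l2_norm (\<lambda>t. T n t - F t) < e/2"
    using eventually_happens'[OF sequentially_bot] by blast
  have [measurable]: "T n \<in> borel_measurable borel"
    unfolding T_def by measurable
  have T: "cmod (T n t) \<le> real n" for t
    by (auto simp: T_def indicator_def)
  obtain h where h: "\<And>m::nat. continuous_on UNIV (h m)" "\<And>m x. cmod (h m x) \<le> real n"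
    and lim: "AE x in lborel. (\<lambda>m. h m x) \<longlonglongrightarrow> T n x"
    using bounded_measurable_AE_limit_continuous[of "T n" "real n"] T by auto
  define cut :: "real \<Rightarrow> complex" where "cut t = of_real (max 0 (min 1 (real n + 1 - \<bar>t\<bar>)))" for t
  have cut: "continuous_on UNIV cut"
    unfolding cut_def by (intro continuous_intros)
  have hc: "continuous_on UNIV (\<lambda>t. h m t * cut t)" for m
    by (intro continuous_intros h cut)
  have [measurable]: "(\<lambda>t. h m t * cut t) \<in> borel_measurable borel" for m
    using hc by (rule borel_measurable_continuous_onI)
  define w where "w t = real n * indicator {-(real n + 1)..real n + 1} t" for t
  have w: "integrable lborel (\<lambda>t. (w t)\<^sup>2)"
    unfolding w_def by (rule integrable_indicator_Icc_power2)
  have bound: "cmod (h m t * cut t) \<le> w t" for m t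
  proof -
    have "cmod (h m t * cut t) \<le> real n * 1"
      unfolding norm_mult by (intro mult_mono h) (auto simp: cut_def)
    moreover have "cut t = 0" if "\<not> (-(real n + 1) \<le> t \<and> t \<le> real n + 1)"
      using that by (auto simp: cut_def)
    ultimately show ?thesis by (auto simp: w_def indicator_def)
  qed
  have "(\<lambda>m. l2_norm (\<lambda>t. h m t * cut t - T n t)) \<longlonglongrightarrow> 0"
  proof (rule l2_dominated_convergence)
    show "AE t in lborel. (\<lambda>m. h m t * cut t) \<longlonglongrightarrow> T n t"
      using lim
    proof eventually_elim
      fix t assume "(\<lambda>m. h m t) \<longlonglongrightarrow> T n t"
      then have "(\<lambda>m. h m t * cut t) \<longlonglongrightarrow> T n t * cut t"
        by (intro tendsto_intros)
      moreover have "T n t * cut t = T n t"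
        by (auto simp: T_def cut_def indicator_def)
      ultimately show "(\<lambda>m. h m t * cut t) \<longlonglongrightarrow> T n t" by simp
    qed
  qed (use w bound in auto)
  then have "\<forall>\<^sub>F m in sequentially. l2_norm (\<lambda>t. h m t * cut t - T n t) < e/2"
    using \<open>e > 0\<close> by (intro order_tendstoD(2)) auto
  then obtain m where m: "l2_norm (\<lambda>t. h m t * cut t - T n t) < e/2"
    using eventually_happens'[OF sequentially_bot] by blast
  have sq: "square_integrable (\<lambda>t. h m t * cut t)"
    unfolding square_integrable_def
  proof
    show "integrable lborel (\<lambda>t. (cmod (h m t * cut t))\<^sup>2)"
    proof (rule Bochner_Integration.integrable_bound[OF w])
      show "AE t in lborel. norm ((cmod (h m t * cut t))\<^sup>2) \<le> norm ((w t)\<^sup>2)"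
        using bound[of m] by (auto intro!: power_mono)
    qed measurable
  qed measurable
  have sqT: "square_integrable (T n)"
  proof -
    have "integrable lborel (\<lambda>t. (cmod (T n t))\<^sup>2)"
      by (rule Bochner_Integration.integrable_bound[OF square_integrableD[OF F]])
        (auto simp: T_def indicator_def)
    then show ?thesis by (simp add: square_integrable_def)
  qed
  show thesis
  proof (rule that[of "\<lambda>t. h m t * cut t" "real n" "real n + 1"])
    show "l2_norm (\<lambda>t. h m t * cut t - F t) < e"
      using l2_norm_triangle_diff[OF sq sqT F] n m by simp
    show "cmod (h m t * cut t) \<le> real n" for t
      by (rule order_trans[OF bound]) (simp add: w_def indicator_def)
    show "h m t * cut t = 0" if "\<bar>t\<bar> > real n + 1" for t
      using that by (simp add: cut_def)
  qed (use hc sq in auto)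
qed

text \<open>For a continuous function of compact support this is dominated convergence. In general it follows by
  approximation, since translations are isometries.\<close>

lemma l2_translation_continuous:
  assumes F: "square_integrable F" and u: "u \<longlonglongrightarrow> 0"
  shows "(\<lambda>n. l2_norm (\<lambda>t. F (t + u n) - F t)) \<longlonglongrightarrow> 0"
proof (rule LIMSEQ_I)
  fix e :: real assume "e > 0"
  then obtain H M R where H: "continuous_on UNIV H" "\<And>t. cmod (H t) \<le> M"
    "\<And>t. \<bar>t\<bar> > R \<Longrightarrow> H t = 0" "square_integrable H" and FH: "l2_norm (\<lambda>t. H t - F t) < e/3"
    using l2_continuous_approx[OF F, of "e/3"] by auto
  have Hm [measurable]: "H \<in> borel_measurable borel"
    using H(4) by measurable
  obtain b where b: "\<And>n. \<bar>u n\<bar> \<le> b"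
    using u by (metis convergentI convergent_imp_Bseq Bseq_def real_norm_def)
  have "(\<lambda>n. l2_norm (\<lambda>t. H (t + u n) - H t)) \<longlonglongrightarrow> 0"
  proof (rule l2_dominated_convergence)
    show "integrable lborel (\<lambda>t. (M * indicator {-(R + b)..R + b} t)\<^sup>2)"
      by (rule integrable_indicator_Icc_power2)
    show "AE t in lborel. cmod (H (t + u n)) \<le> M * indicator {-(R + b)..R + b} t" for n
    proof (intro AE_I2)
      fix t
      show "cmod (H (t + u n)) \<le> M * indicator {-(R + b)..R + b} t"
      proof (cases "t \<in> {-(R + b)..R + b}")
        case False
        then have "\<bar>t + u n\<bar> > R" using b[of n] by auto
        then show ?thesis using H(3) False by simp
      qed (simp add: H)
    qed
    show "AE t in lborel. (\<lambda>n. H (t + u n)) \<longlonglongrightarrow> H t"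
    proof (intro AE_I2)
      fix t
      have "(\<lambda>n. t + u n) \<longlonglongrightarrow> t + 0" by (intro tendsto_intros u)
      from continuous_on_tendsto_compose[OF H(1) this]
      show "(\<lambda>n. H (t + u n)) \<longlonglongrightarrow> H t" by simp
    qed
  qed measurable
  then obtain N where N: "\<And>n. n \<ge> N \<Longrightarrow> l2_norm (\<lambda>t. H (t + u n) - H t) < e/3"
    using LIMSEQ_D[of _ 0 "e/3"] \<open>e > 0\<close> by fastforce
  have "l2_norm (\<lambda>t. F (t + u n) - F t) < e" if "n \<ge> N" for n
  proof -
    have "l2_norm (\<lambda>t. F (t + u n) - F t)
        \<le> l2_norm (\<lambda>t. F (t + u n) - H (t + u n)) + l2_norm (\<lambda>t. H (t + u n) - F t)"
      using F H(4) by (intro l2_norm_triangle_diff square_integrable_shift)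
    also have "l2_norm (\<lambda>t. H (t + u n) - F t)
        \<le> l2_norm (\<lambda>t. H (t + u n) - H t) + l2_norm (\<lambda>t. H t - F t)"
      using F H(4) by (intro l2_norm_triangle_diff square_integrable_shift)
    also have "l2_norm (\<lambda>t. F (t + u n) - H (t + u n)) = l2_norm (\<lambda>t. H t - F t)"
      using l2_norm_shift[of "\<lambda>t. F t - H t"] by (simp add: l2_norm_minus_commute[of H F])
    finally show ?thesis using FH N[OF that] by simp
  qed
  then show "\<exists>N. \<forall>n\<ge>N. norm (l2_norm (\<lambda>t. F (t + u n) - F t) - 0) < e"
    by auto
qed

section \<open>Plancherel's theorem and the Fourier transform on \<open>L\<^sup>2\<close>\<close>

lemma cmod_exp_i [simp]: "cmod (exp (- (\<i> * of_real x * of_real y))) = 1"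
  by (simp add: norm_exp_eq_Re)

lemma fourier_L1_measurable [measurable]:
  assumes [measurable]: "F \<in> borel_measurable borel"
  shows "fourier_L1 F \<in> borel_measurable borel"
proof -
  have "(\<lambda>\<xi>. LINT t|lborel. F t * exp (- \<i> * of_real \<xi> * of_real t)) \<in> borel_measurable borel"
    by measurable
  then show ?thesis by (simp add: fourier_L1_def[abs_def])
qed

lemma integrable_fourier_L1:
  assumes "integrable lborel F"
  shows "integrable lborel (\<lambda>t. F t * exp (- \<i> * of_real \<xi> * of_real t))"
proof (rule Bochner_Integration.integrable_bound[OF assms])
  have [measurable]: "F \<in> borel_measurable borel" using assms by auto
  show "(\<lambda>t. F t * exp (- \<i> * of_real \<xi> * of_real t)) \<in> borel_measurable lborel" by measurable
qed (simp add: norm_mult)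

lemma cmod_fourier_L1_le:
  assumes "integrable lborel F"
  shows "cmod (fourier_L1 F \<xi>) \<le> (LINT t|lborel. cmod (F t))"
proof -
  have "cmod (fourier_L1 F \<xi>) \<le> (LINT t|lborel. cmod (F t * exp (- \<i> * of_real \<xi> * of_real t)))"
    unfolding fourier_L1_def by (rule integral_norm_bound)
  then show ?thesis by (simp add: norm_mult)
qed

lemma fourier_L1_add:
  assumes "integrable lborel F" "integrable lborel G"
  shows "fourier_L1 (\<lambda>t. F t + G t) \<xi> = fourier_L1 F \<xi> + fourier_L1 G \<xi>"
  using integrable_fourier_L1[OF assms(1), of \<xi>] integrable_fourier_L1[OF assms(2), of \<xi>]
  by (simp add: fourier_L1_def distrib_right)

lemma fourier_L1_cmult: "fourier_L1 (\<lambda>t. c * F t) \<xi> = c * fourier_L1 F \<xi>"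
  by (simp add: fourier_L1_def mult.assoc)

lemma fourier_L1_diff:
  assumes "integrable lborel F" "integrable lborel G"
  shows "fourier_L1 (\<lambda>t. F t - G t) \<xi> = fourier_L1 F \<xi> - fourier_L1 G \<xi>"
  using fourier_L1_add[of F "\<lambda>t. -1 * G t" \<xi>] fourier_L1_cmult[of "-1" G \<xi>] assms by simp

lemma fourier_L1_shift:
  "fourier_L1 (\<lambda>t. F (t + a)) \<xi> = exp (\<i> * of_real \<xi> * of_real a) * fourier_L1 F \<xi>"
proof -
  have "fourier_L1 F \<xi> = (LINT t|lborel. F (a + t) * exp (- \<i> * of_real \<xi> * of_real (a + t)))"
    using lborel_integral_real_affine[of 1 "\<lambda>t. F t * exp (- \<i> * of_real \<xi> * of_real t)" a]
    by (simp add: fourier_L1_def)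
  also have "\<dots> = (LINT t|lborel. exp (- \<i> * of_real \<xi> * of_real a) * (F (t + a) * exp (- \<i> * of_real \<xi> * of_real t)))"
    by (intro Bochner_Integration.integral_cong) (auto simp: algebra_simps exp_add exp_diff exp_minus divide_simps)
  also have "\<dots> = exp (- \<i> * of_real \<xi> * of_real a) * fourier_L1 (\<lambda>t. F (t + a)) \<xi>"
    by (simp add: fourier_L1_def)
  finally show ?thesis by (simp add: exp_minus field_simps)
qed

definition autocorrelation :: "(real \<Rightarrow> complex) \<Rightarrow> real \<Rightarrow> complex" where
  "autocorrelation F u = (LINT t|lborel. F (t + u) * cnj (F t))"

lemma autocorrelation_eq_l2_inner: "autocorrelation F u = l2_inner (\<lambda>t. F (t + u)) F"
  by (simp add: autocorrelation_def l2_inner_def)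

text \<open>An inner product of \<open>F\<close> with a translate of itself: bounded by Cauchy--Schwarz and, in the next lemma,
  continuous at the origin because translation is continuous in \<open>L\<^sup>2\<close>.\<close>

lemma cmod_autocorrelation_le:
  "square_integrable F \<Longrightarrow> cmod (autocorrelation F u) \<le> (l2_norm F)\<^sup>2"
  using Cauchy_Schwarz_l2[of "\<lambda>t. F (t + u)" F]
  by (simp add: autocorrelation_eq_l2_inner l2_norm_shift square_integrable_shift power2_eq_square)

lemma autocorrelation_tendsto:
  assumes F: "square_integrable F" and "u \<longlonglongrightarrow> 0"
  shows "(\<lambda>n. autocorrelation F (u n)) \<longlonglongrightarrow> of_real ((l2_norm F)\<^sup>2)"
proof (rule metric_tendsto_imp_tendsto)
  show "(\<lambda>n. l2_norm (\<lambda>t. F (t + u n) - F t) * l2_norm F) \<longlonglongrightarrow> 0"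
    using tendsto_mult_right[OF l2_translation_continuous[OF assms], of "l2_norm F"] by simp
  show "\<forall>\<^sub>F n in sequentially. dist (autocorrelation F (u n)) (of_real ((l2_norm F)\<^sup>2))
      \<le> dist (l2_norm (\<lambda>t. F (t + u n) - F t) * l2_norm F) 0"
  proof (rule always_eventually, rule allI)
    fix n
    have sh: "square_integrable (\<lambda>t. F (t + u n))"
      using F by (rule square_integrable_shift)
    have "autocorrelation F (u n) - of_real ((l2_norm F)\<^sup>2) = l2_inner (\<lambda>t. F (t + u n) - F t) F"
      using integrable_mult_cnj[OF sh F] integrable_mult_cnj[OF F F]
      unfolding l2_inner_self[symmetric] by (simp add: autocorrelation_def l2_inner_def left_diff_distrib)
    then show "dist (autocorrelation F (u n)) (of_real ((l2_norm F)\<^sup>2))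
        \<le> dist (l2_norm (\<lambda>t. F (t + u n) - F t) * l2_norm F) 0"
      using Cauchy_Schwarz_l2[of "\<lambda>t. F (t + u n) - F t" F] sh F by (simp add: dist_norm)
  qed
qed

lemma integrable_autocorrelation_kernel:
  fixes F :: "real \<Rightarrow> complex"
  assumes F: "integrable lborel F"
  shows "integrable (lborel \<Otimes>\<^sub>M lborel) (\<lambda>(t, u). F (t + u) * cnj (F t))"
proof -
  have [measurable]: "F \<in> borel_measurable borel" using F by auto
  have shift: "integrable lborel (\<lambda>u. F (t + u))" for t
    using lborel_integrable_real_affine[OF F, of 1 t] by simp
  show ?thesis
  proof (rule lborel_pair.Fubini_integrable)
    have "(LINT u|lborel. norm (F (t + u) * cnj (F t))) = (LINT u|lborel. cmod (F u)) * cmod (F t)" for t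
      using lborel_integral_real_affine[of 1 "\<lambda>u. cmod (F u)" t] by (simp add: norm_mult)
    then show "integrable lborel (\<lambda>t. LINT u|lborel. norm (case (t, u) of (t, u) \<Rightarrow> F (t + u) * cnj (F t)))"
      using F by simp
    show "AE t in lborel. integrable lborel (\<lambda>u. case (t, u) of (t, u) \<Rightarrow> F (t + u) * cnj (F t))"
      using shift by simp
  qed measurable
qed

lemma integrable_autocorrelation:
  assumes "integrable lborel F"
  shows "integrable lborel (autocorrelation F)"
  using lborel_pair.integrable_fst'[OF lborel_pair.integrable_product_swap[OF integrable_autocorrelation_kernel[OF assms]]]
  by (simp add: autocorrelation_def[abs_def])

text \<open>After exchanging the integrals, the substitution \<open>s = t + u\<close> factors the double integral into the
  transform of \<open>F\<close> and its conjugate.\<close>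

lemma fourier_L1_autocorrelation:
  assumes F: "integrable lborel F"
  shows "fourier_L1 (autocorrelation F) \<xi> = of_real ((cmod (fourier_L1 F \<xi>))\<^sup>2)"
proof -
  let ?e = "\<lambda>x. exp (- \<i> * of_real \<xi> * of_real x)"
  have [measurable]: "F \<in> borel_measurable borel" using F by auto
  have int: "integrable (lborel \<Otimes>\<^sub>M lborel) (\<lambda>(t, u). F (t + u) * cnj (F t) * ?e u)"
    by (rule Bochner_Integration.integrable_bound[OF integrable_autocorrelation_kernel[OF F]])
      (auto simp: norm_mult split: prod.split)
  have "fourier_L1 (autocorrelation F) \<xi> = (LINT u|lborel. LINT t|lborel. F (t + u) * cnj (F t) * ?e u)"
    by (simp add: fourier_L1_def autocorrelation_def)
  also have "\<dots> = (LINT t|lborel. LINT u|lborel. F (t + u) * cnj (F t) * ?e u)"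
    using lborel_pair.Fubini_integral[OF int] by simp
  also have "\<dots> = (LINT t|lborel. cnj (F t * ?e t) * fourier_L1 F \<xi>)"
  proof (intro Bochner_Integration.integral_cong refl)
    fix t
    have "(LINT u|lborel. F (t + u) * cnj (F t) * ?e u) = cnj (F t) * fourier_L1 (\<lambda>u. F (u + t)) \<xi>"
      by (simp add: fourier_L1_def ac_simps flip: integral_mult_right_zero)
    then show "(LINT u|lborel. F (t + u) * cnj (F t) * ?e u) = cnj (F t * ?e t) * fourier_L1 F \<xi>"
      by (simp add: fourier_L1_shift exp_cnj)
  qed
  also have "\<dots> = cnj (fourier_L1 F \<xi>) * fourier_L1 F \<xi>"
    by (simp add: fourier_L1_def integral_cnj[symmetric] del: complex_cnj_mult integral_cnj)
  also have "\<dots> = of_real ((cmod (fourier_L1 F \<xi>))\<^sup>2)"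
    by (simp add: complex_norm_square[symmetric] mult.commute)
  finally show ?thesis .
qed

text \<open>Fubini moves the Gaussian from the frequency side to the time side. There it reappears with the
  reciprocal width, because the standard normal distribution has a Gaussian characteristic function.\<close>

lemma gaussian_mean_fourier_L1:
  assumes r: "integrable lborel r" and "\<epsilon> > 0"
  shows "(LINT x|lborel. of_real (std_normal_density x) * fourier_L1 r (x / \<epsilon>))
       = of_real (\<epsilon> * sqrt (2 * pi)) * (LINT v|lborel. of_real (std_normal_density v) * r (\<epsilon> * v))"
proof -
  have [measurable]: "r \<in> borel_measurable borel" using r by auto
  let ?k = "\<lambda>x u. of_real (std_normal_density x) * (r u * exp (- \<i> * of_real (x / \<epsilon>) * of_real u))"
  have int: "integrable (lborel \<Otimes>\<^sub>M lborel) (\<lambda>(x, u). ?k x u)"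
  proof (rule lborel_pair.Fubini_integrable)
    have "(LINT u|lborel. norm (?k x u)) = std_normal_density x * (LINT u|lborel. cmod (r u))" for x
      by (simp add: norm_mult normal_density_nonneg)
    then show "integrable lborel (\<lambda>x. LINT u|lborel. norm (case (x, u) of (x, u) \<Rightarrow> ?k x u))"
      by simp
    show "AE x in lborel. integrable lborel (\<lambda>u. case (x, u) of (x, u) \<Rightarrow> ?k x u)"
      using integrable_fourier_L1[OF r, of "x / \<epsilon>" for x] by (intro AE_I2) auto
  qed measurable
  have char: "(LINT x|lborel. ?k x u) = r u * of_real (exp (- (u / \<epsilon>)\<^sup>2 / 2))" for u
  proof -
    have "of_real (exp (- (u / \<epsilon>)\<^sup>2 / 2)) = char std_normal_distribution (- u / \<epsilon>)"
      by (simp add: char_std_normal_distribution power_divide)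
    also have "\<dots> = (LINT x|lborel. of_real (std_normal_density x) * iexp (- u / \<epsilon> * x))"
      unfolding char_def by (subst integral_density) (auto simp: normal_density_nonneg scaleR_conv_of_real)
    finally have "r u * of_real (exp (- (u / \<epsilon>)\<^sup>2 / 2))
        = (LINT x|lborel. r u * (of_real (std_normal_density x) * iexp (- u / \<epsilon> * x)))"
      by simp
    also have "\<dots> = (LINT x|lborel. ?k x u)"
      by (intro Bochner_Integration.integral_cong) (auto simp: ac_simps)
    finally show ?thesis ..
  qed
  have "(LINT x|lborel. of_real (std_normal_density x) * fourier_L1 r (x / \<epsilon>)) = (LINT x|lborel. LINT u|lborel. ?k x u)"
    by (simp add: fourier_L1_def)
  also have "\<dots> = (LINT u|lborel. LINT x|lborel. ?k x u)"
    using lborel_pair.Fubini_integral[OF int] by simp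
  also have "\<dots> = (LINT u|lborel. r u * of_real (exp (- (u / \<epsilon>)\<^sup>2 / 2)))"
    by (simp only: char)
  also have "\<dots> = of_real \<epsilon> * (LINT v|lborel. r (\<epsilon> * v) * of_real (exp (- v\<^sup>2 / 2)))"
    using lborel_integral_real_affine[of \<epsilon> "\<lambda>u. r u * of_real (exp (- (u / \<epsilon>)\<^sup>2 / 2))" 0] \<open>\<epsilon> > 0\<close>
    by (simp add: scaleR_conv_of_real)
  also have "(LINT v|lborel. r (\<epsilon> * v) * of_real (exp (- v\<^sup>2 / 2)))
      = of_real (sqrt (2 * pi)) * (LINT v|lborel. of_real (std_normal_density v) * r (\<epsilon> * v))"
    by (subst integral_mult_right_zero[symmetric], intro Bochner_Integration.integral_cong)
      (auto simp: std_normal_density_def)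
  finally show ?thesis by (simp add: mult.assoc)
qed

text \<open>Weighted by a Gaussian of width \<open>1 / \<epsilon>\<close>, the energy of the transform is a Gaussian
  average of the autocorrelation at scale \<open>\<epsilon>\<close>. As \<open>\<epsilon> \<rightarrow> 0\<close> the weights increase to \<open>1\<close>, while the
  average tends to the value of the autocorrelation at the origin.\<close>

theorem Plancherel_L1:
  assumes F: "integrable lborel F" and F2: "square_integrable F"
  shows "square_integrable (fourier_L1 F)"
    and "(l2_norm (fourier_L1 F))\<^sup>2 = 2 * pi * (l2_norm F)\<^sup>2"
proof -
  have [measurable]: "F \<in> borel_measurable borel" using F by auto
  define \<epsilon> where "\<epsilon> n = inverse (real (Suc n))" for n
  have pos: "\<epsilon> n > 0" for n by (simp add: \<epsilon>_def)
  have \<epsilon>0: "\<epsilon> \<longlonglongrightarrow> 0"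
    unfolding \<epsilon>_def by (rule LIMSEQ_inverse_real_of_nat)
  let ?f = "fourier_L1 F" and ?r = "autocorrelation F"
  have rm [measurable]: "?r \<in> borel_measurable borel"
    using integrable_autocorrelation[OF F] by auto
  let ?A = "\<lambda>n. (LINT v|lborel. of_real (std_normal_density v) * ?r (\<epsilon> n * v))"
  define w where "w n \<xi> = exp (- (\<epsilon> n * \<xi>)\<^sup>2 / 2)" for n \<xi>
  have energy: "(\<integral>\<^sup>+\<xi>. ennreal ((cmod (?f \<xi>))\<^sup>2 * w n \<xi>) \<partial>lborel) = ennreal (2 * pi * Re (?A n))" for n
  proof -
    let ?g = "\<lambda>x. std_normal_density x * (cmod (?f (x / \<epsilon> n)))\<^sup>2"
    have int: "integrable lborel ?g"
    proof (rule Bochner_Integration.integrable_bound)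
      show "integrable lborel (\<lambda>x. std_normal_density x * (LINT t|lborel. cmod (F t))\<^sup>2)" by simp
      show "AE x in lborel. norm (?g x) \<le> norm (std_normal_density x * (LINT t|lborel. cmod (F t))\<^sup>2)"
        using cmod_fourier_L1_le[OF F]
        by (auto simp: abs_mult normal_density_nonneg intro!: mult_left_mono power_mono)
    qed measurable
    have "of_real (LINT x|lborel. ?g x) = (LINT x|lborel. of_real (std_normal_density x) * fourier_L1 ?r (x / \<epsilon> n))"
      by (simp add: fourier_L1_autocorrelation[OF F] flip: integral_complex_of_real)
    also have "\<dots> = of_real (\<epsilon> n * sqrt (2 * pi)) * ?A n"
      by (rule gaussian_mean_fourier_L1[OF integrable_autocorrelation[OF F] pos])
    finally have "complex_of_real (LINT x|lborel. ?g x) = of_real (\<epsilon> n * sqrt (2 * pi)) * ?A n" .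
    from arg_cong[where f=Re, OF this]
    have eq: "(LINT x|lborel. ?g x) = \<epsilon> n * sqrt (2 * pi) * Re (?A n)"
      by (simp del: of_real_mult)
    have "(\<integral>\<^sup>+\<xi>. ennreal ((cmod (?f \<xi>))\<^sup>2 * w n \<xi>) \<partial>lborel)
        = ennreal (1 / \<epsilon> n) * (\<integral>\<^sup>+x. ennreal (sqrt (2 * pi) * ?g x) \<partial>lborel)"
      unfolding w_def using pos[of n]
      by (subst nn_integral_real_affine[where c="1 / \<epsilon> n" and t=0])
        (auto simp: std_normal_density_def ac_simps intro!: arg_cong2[where f="(*)"] nn_integral_cong)
    also have "(\<integral>\<^sup>+x. ennreal (sqrt (2 * pi) * ?g x) \<partial>lborel) = ennreal (sqrt (2 * pi) * (LINT x|lborel. ?g x))"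
      using int by (subst nn_integral_eq_integral) (auto simp: normal_density_nonneg)
    also have "ennreal (1 / \<epsilon> n) * \<dots> = ennreal (2 * pi * Re (?A n))"
    proof -
      have "1 / \<epsilon> n * (sqrt (2 * pi) * (\<epsilon> n * sqrt (2 * pi) * Re (?A n)))
          = (sqrt (2 * pi) * sqrt (2 * pi)) * Re (?A n)"
        using pos[of n] by (simp del: real_sqrt_mult_self)
      also have "\<dots> = 2 * pi * Re (?A n)" by simp
      finally show ?thesis
        unfolding eq using pos[of n] by (subst ennreal_mult'[symmetric]) (simp, simp only:)
    qed
    finally show ?thesis .
  qed
  have "?A \<longlonglongrightarrow> (LINT v|lborel. of_real (std_normal_density v) * of_real ((l2_norm F)\<^sup>2))"
  proof (rule integral_dominated_convergence)
    show "integrable lborel (\<lambda>v. std_normal_density v * (l2_norm F)\<^sup>2)" by simp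
    show "AE v in lborel. (\<lambda>n. of_real (std_normal_density v) * ?r (\<epsilon> n * v))
        \<longlonglongrightarrow> of_real (std_normal_density v) * of_real ((l2_norm F)\<^sup>2)"
      using tendsto_mult_left[OF \<epsilon>0] by (intro AE_I2 tendsto_intros autocorrelation_tendsto F2) (simp add: mult.commute)
    show "AE v in lborel. norm (of_real (std_normal_density v) * ?r (\<epsilon> n * v))
        \<le> std_normal_density v * (l2_norm F)\<^sup>2" for n
      using cmod_autocorrelation_le[OF F2]
      by (auto simp: norm_mult normal_density_nonneg intro!: mult_left_mono)
  qed measurable
  also have "(LINT v|lborel. of_real (std_normal_density v) * of_real ((l2_norm F)\<^sup>2)) = complex_of_real ((l2_norm F)\<^sup>2)"
    by (simp del: of_real_power)
  finally have "(\<lambda>n. Re (?A n)) \<longlonglongrightarrow> Re (complex_of_real ((l2_norm F)\<^sup>2))"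
    by (rule tendsto_Re)
  then have "(\<lambda>n. ennreal (2 * pi * Re (?A n))) \<longlonglongrightarrow> ennreal (2 * pi * (l2_norm F)\<^sup>2)"
    by (intro tendsto_ennrealI tendsto_intros) (simp del: of_real_power)
  then have lim1: "(\<lambda>n. \<integral>\<^sup>+\<xi>. ennreal ((cmod (?f \<xi>))\<^sup>2 * w n \<xi>) \<partial>lborel) \<longlonglongrightarrow> ennreal (2 * pi * (l2_norm F)\<^sup>2)"
    by (simp only: energy)
  have mono: "incseq (\<lambda>n \<xi>. ennreal ((cmod (?f \<xi>))\<^sup>2 * w n \<xi>))"
  proof (intro incseq_SucI le_funI ennreal_leI mult_left_mono)
    fix n \<xi>
    have "(\<epsilon> (Suc n) * \<xi>)\<^sup>2 \<le> (\<epsilon> n * \<xi>)\<^sup>2"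
      unfolding power_mult_distrib by (intro mult_right_mono power_mono) (auto simp: \<epsilon>_def)
    then show "w n \<xi> \<le> w (Suc n) \<xi>" by (simp add: w_def)
  qed auto
  have "(\<lambda>n. \<integral>\<^sup>+\<xi>. ennreal ((cmod (?f \<xi>))\<^sup>2 * w n \<xi>) \<partial>lborel) \<longlonglongrightarrow> (\<integral>\<^sup>+\<xi>. ennreal ((cmod (?f \<xi>))\<^sup>2) \<partial>lborel)"
  proof (rule nn_integral_LIMSEQ[OF mono])
    show "(\<lambda>n. ennreal ((cmod (?f \<xi>))\<^sup>2 * w n \<xi>)) \<longlonglongrightarrow> ennreal ((cmod (?f \<xi>))\<^sup>2)" for \<xi>
    proof -
      have "(\<lambda>n. (cmod (?f \<xi>))\<^sup>2 * w n \<xi>) \<longlonglongrightarrow> (cmod (?f \<xi>))\<^sup>2 * exp (- (0 * \<xi>)\<^sup>2 / 2)"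
        unfolding w_def by (intro tendsto_intros \<epsilon>0) auto
      then show ?thesis by (intro tendsto_ennrealI) simp
    qed
  qed (simp add: w_def)
  from LIMSEQ_unique[OF this lim1]
  have "(\<integral>\<^sup>+\<xi>. ennreal ((cmod (?f \<xi>))\<^sup>2) \<partial>lborel) = ennreal (2 * pi * (l2_norm F)\<^sup>2)" .
  then show "square_integrable ?f" "(l2_norm ?f)\<^sup>2 = 2 * pi * (l2_norm F)\<^sup>2"
    by (auto simp: square_integrable_iff intro!: l2_norm_eqI)
qed

lemma has_fourier_L2_square_integrable:
  assumes "has_fourier_L2 f g"
  shows "square_integrable f" "square_integrable g"
  using assms by (auto simp: has_fourier_L2_def)

text \<open>The truncations of \<open>f\<close> lie in \<open>L\<^sup>1 \<inter> L\<^sup>2\<close>, and by Plancherel's theorem their transforms are Cauchy, since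
  the truncations are.\<close>

lemma has_fourier_L2_exists:
  assumes f: "square_integrable f"
  shows "\<exists>g. has_fourier_L2 f g"
proof -
  note [measurable] = f
  define F where "F n t = f t * indicator {t. \<bar>t\<bar> \<le> real n \<and> cmod (f t) \<le> real n} t" for n t
  have lim: "(\<lambda>n. l2_norm (\<lambda>t. F n t - f t)) \<longlonglongrightarrow> 0"
    unfolding F_def by (rule l2_truncation_tendsto[OF f])
  have Fm [measurable]: "F n \<in> borel_measurable borel" for n
    unfolding F_def by measurable
  have F2: "square_integrable (F n)" for n
  proof -
    have "integrable lborel (\<lambda>t. (cmod (F n t))\<^sup>2)"
      by (rule Bochner_Integration.integrable_bound[OF square_integrableD[OF f]])
        (auto simp: F_def indicator_def)
    then show ?thesis by (simp add: square_integrable_def)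
  qed
  have F1: "integrable lborel (F n)" for n
  proof (rule Bochner_Integration.integrable_bound)
    show "integrable lborel (\<lambda>t. real n * indicator {- real n..real n} t)"
      by (intro integrable_mult_right integrable_real_indicator) (auto simp: emeasure_lborel_Icc_eq)
  qed (auto simp: F_def indicator_def)
  have hat2: "square_integrable (fourier_L1 (F n))" for n
    by (rule Plancherel_L1(1)[OF F1 F2])
  have dist: "l2_norm (\<lambda>\<xi>. fourier_L1 (F m) \<xi> - fourier_L1 (F n) \<xi>) = sqrt (2 * pi) * l2_norm (\<lambda>t. F m t - F n t)" for m n
  proof -
    have "(l2_norm (\<lambda>\<xi>. fourier_L1 (F m) \<xi> - fourier_L1 (F n) \<xi>))\<^sup>2 = 2 * pi * (l2_norm (\<lambda>t. F m t - F n t))\<^sup>2"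
      using Plancherel_L1(2)[of "\<lambda>t. F m t - F n t"] F1 F2
      by (simp add: ext[OF fourier_L1_diff[OF F1 F1]])
    then have "sqrt ((l2_norm (\<lambda>\<xi>. fourier_L1 (F m) \<xi> - fourier_L1 (F n) \<xi>))\<^sup>2) = sqrt (2 * pi * (l2_norm (\<lambda>t. F m t - F n t))\<^sup>2)"
      by simp
    then show ?thesis by (simp add: real_sqrt_mult)
  qed
  obtain g where g: "square_integrable g" "(\<lambda>n. l2_norm (\<lambda>\<xi>. fourier_L1 (F n) \<xi> - g \<xi>)) \<longlonglongrightarrow> 0"
  proof (rule l2_complete[of "\<lambda>n. fourier_L1 (F n)"])
    fix e :: real assume "e > 0"
    define d where "d = e / (2 * sqrt (2 * pi))"
    have "d > 0" using \<open>e > 0\<close> by (simp add: d_def)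
    then obtain N where N: "\<And>n. n \<ge> N \<Longrightarrow> l2_norm (\<lambda>t. F n t - f t) < d"
      using LIMSEQ_D[OF lim] by fastforce
    have "l2_norm (\<lambda>\<xi>. fourier_L1 (F m) \<xi> - fourier_L1 (F n) \<xi>) < e" if "m \<ge> N" "n \<ge> N" for m n
    proof -
      have "l2_norm (\<lambda>t. F m t - F n t) < d + d"
        using l2_norm_triangle_diff[OF F2 f F2, of m n] N[OF that(1)] N[OF that(2)]
        by (simp add: l2_norm_minus_commute[of f])
      then have "sqrt (2 * pi) * l2_norm (\<lambda>t. F m t - F n t) < sqrt (2 * pi) * (d + d)"
        by (intro mult_strict_left_mono) auto
      also have "\<dots> = e" by (simp add: d_def)
      finally show ?thesis by (simp only: dist)
    qed
    then show "\<exists>N. \<forall>m\<ge>N. \<forall>n\<ge>N. l2_norm (\<lambda>\<xi>. fourier_L1 (F m) \<xi> - fourier_L1 (F n) \<xi>) < e"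
      by blast
  qed (use hat2 in auto)
  then have "has_fourier_L2 f g"
    unfolding has_fourier_L2_def using f F1 F2 hat2 lim by blast
  then show ?thesis by blast
qed

lemma has_fourier_L2_fourier_L2: "square_integrable f \<Longrightarrow> has_fourier_L2 f (fourier_L2 f)"
  unfolding fourier_L2_def using has_fourier_L2_exists by (rule someI_ex)

lemma Plancherel_L2:
  assumes "has_fourier_L2 f g"
  shows "(l2_norm g)\<^sup>2 = 2 * pi * (l2_norm f)\<^sup>2"
proof -
  from assms obtain F where f: "square_integrable f" and g: "square_integrable g"
    and F: "\<And>n. integrable lborel (F n)" "\<And>n::nat. square_integrable (F n)"
      "\<And>n. square_integrable (fourier_L1 (F n))"
    and lim: "(\<lambda>n. l2_norm (\<lambda>t. F n t - f t)) \<longlonglongrightarrow> 0"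
      "(\<lambda>n. l2_norm (\<lambda>\<xi>. fourier_L1 (F n) \<xi> - g \<xi>)) \<longlonglongrightarrow> 0"
    by (auto simp: has_fourier_L2_def)
  have left: "(\<lambda>n. 2 * pi * (l2_norm (F n))\<^sup>2) \<longlonglongrightarrow> 2 * pi * (l2_norm f)\<^sup>2"
    by (intro tendsto_intros l2_norm_tendsto F f lim)
  have "(\<lambda>n. (l2_norm (fourier_L1 (F n)))\<^sup>2) \<longlonglongrightarrow> (l2_norm g)\<^sup>2"
    by (intro tendsto_intros l2_norm_tendsto F g lim)
  then have "(\<lambda>n. 2 * pi * (l2_norm (F n))\<^sup>2) \<longlonglongrightarrow> (l2_norm g)\<^sup>2"
    by (simp only: Plancherel_L1(2)[OF F(1,2)])
  then show ?thesis
    using left by (rule LIMSEQ_unique)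
qed

lemma has_fourier_L2_add:
  assumes "has_fourier_L2 f g" "has_fourier_L2 f' g'"
  shows "has_fourier_L2 (\<lambda>t. f t + f' t) (\<lambda>\<xi>. g \<xi> + g' \<xi>)"
proof -
  from assms(1) obtain F where f: "square_integrable f" and g: "square_integrable g"
    and F: "\<And>n. integrable lborel (F n)" "\<And>n::nat. square_integrable (F n)"
      "\<And>n. square_integrable (fourier_L1 (F n))"
    and lim: "(\<lambda>n. l2_norm (\<lambda>t. F n t - f t)) \<longlonglongrightarrow> 0"
      "(\<lambda>n. l2_norm (\<lambda>\<xi>. fourier_L1 (F n) \<xi> - g \<xi>)) \<longlonglongrightarrow> 0"
    by (auto simp: has_fourier_L2_def)
  from assms(2) obtain F' where f': "square_integrable f'" and g': "square_integrable g'"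
    and F': "\<And>n. integrable lborel (F' n)" "\<And>n::nat. square_integrable (F' n)"
      "\<And>n. square_integrable (fourier_L1 (F' n))"
    and lim': "(\<lambda>n. l2_norm (\<lambda>t. F' n t - f' t)) \<longlonglongrightarrow> 0"
      "(\<lambda>n. l2_norm (\<lambda>\<xi>. fourier_L1 (F' n) \<xi> - g' \<xi>)) \<longlonglongrightarrow> 0"
    by (auto simp: has_fourier_L2_def)
  have sum: "(\<lambda>n. l2_norm (\<lambda>t. (u n t + u' n t) - (v t + v' t))) \<longlonglongrightarrow> 0"
    if "\<And>n. square_integrable (u n)" "\<And>n. square_integrable (u' n)" "square_integrable v" "square_integrable v'"
      and "(\<lambda>n. l2_norm (\<lambda>t. u n t - v t)) \<longlonglongrightarrow> 0" "(\<lambda>n. l2_norm (\<lambda>t. u' n t - v' t)) \<longlonglongrightarrow> 0"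
    for u u' :: "nat \<Rightarrow> real \<Rightarrow> complex" and v v'
  proof (rule tendsto_sandwich[OF _ _ tendsto_const])
    show "\<forall>\<^sub>F n in sequentially. l2_norm (\<lambda>t. (u n t + u' n t) - (v t + v' t))
        \<le> l2_norm (\<lambda>t. u n t - v t) + l2_norm (\<lambda>t. u' n t - v' t)"
      using l2_norm_triangle[OF square_integrable_diff[OF that(1,3)] square_integrable_diff[OF that(2,4)]]
      by (simp add: algebra_simps)
    show "(\<lambda>n. l2_norm (\<lambda>t. u n t - v t) + l2_norm (\<lambda>t. u' n t - v' t)) \<longlonglongrightarrow> 0"
      using tendsto_add[OF that(5,6)] by simp
  qed simp
  show ?thesis
    unfolding has_fourier_L2_def
  proof (intro conjI exI[of _ "\<lambda>n t. F n t + F' n t"] allI)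
    show "(\<lambda>n. l2_norm (\<lambda>t. F n t + F' n t - (f t + f' t))) \<longlonglongrightarrow> 0"
      by (intro sum F F' f f' lim lim')
    have "fourier_L1 (\<lambda>t. F n t + F' n t) = (\<lambda>\<xi>. fourier_L1 (F n) \<xi> + fourier_L1 (F' n) \<xi>)" for n
      using fourier_L1_add[OF F(1) F'(1)] by blast
    then show "(\<lambda>n. l2_norm (\<lambda>\<xi>. fourier_L1 (\<lambda>t. F n t + F' n t) \<xi> - (g \<xi> + g' \<xi>))) \<longlonglongrightarrow> 0"
      and "square_integrable (fourier_L1 (\<lambda>t. F n t + F' n t))" for n
      using sum[OF F(3) F'(3) g g' lim(2) lim'(2)] F(3) F'(3) by simp_all
  qed (use F F' f f' g g' in auto)
qed

lemma has_fourier_L2_cmult: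
  assumes "has_fourier_L2 f g"
  shows "has_fourier_L2 (\<lambda>t. c * f t) (\<lambda>\<xi>. c * g \<xi>)"
proof -
  from assms obtain F where f: "square_integrable f" and g: "square_integrable g"
    and F: "\<And>n. integrable lborel (F n)" "\<And>n::nat. square_integrable (F n)"
      "\<And>n. square_integrable (fourier_L1 (F n))"
    and lim: "(\<lambda>n. l2_norm (\<lambda>t. F n t - f t)) \<longlonglongrightarrow> 0"
      "(\<lambda>n. l2_norm (\<lambda>\<xi>. fourier_L1 (F n) \<xi> - g \<xi>)) \<longlonglongrightarrow> 0"
    by (auto simp: has_fourier_L2_def)
  have eq: "fourier_L1 (\<lambda>t. c * F n t) = (\<lambda>\<xi>. c * fourier_L1 (F n) \<xi>)" for n
    using fourier_L1_cmult by blast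
  have "(\<lambda>n. l2_norm (\<lambda>t. c * F n t - c * f t)) \<longlonglongrightarrow> 0"
    "(\<lambda>n. l2_norm (\<lambda>\<xi>. c * fourier_L1 (F n) \<xi> - c * g \<xi>)) \<longlonglongrightarrow> 0"
    using tendsto_mult_right[OF lim(1), of "cmod c"] tendsto_mult_right[OF lim(2), of "cmod c"]
    by (simp_all add: l2_norm_cmult mult.commute flip: right_diff_distrib)
  then show ?thesis
    unfolding has_fourier_L2_def using f g F
    by (intro conjI exI[of _ "\<lambda>n t. c * F n t"]) (auto simp: eq)
qed

lemma has_fourier_L2_shift:
  assumes "has_fourier_L2 f g"
  shows "has_fourier_L2 (\<lambda>t. f (t + a)) (\<lambda>\<xi>. exp (\<i> * of_real \<xi> * of_real a) * g \<xi>)"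
proof -
  from assms obtain F where f: "square_integrable f" and g: "square_integrable g"
    and F: "\<And>n. integrable lborel (F n)" "\<And>n::nat. square_integrable (F n)"
      "\<And>n. square_integrable (fourier_L1 (F n))"
    and lim: "(\<lambda>n. l2_norm (\<lambda>t. F n t - f t)) \<longlonglongrightarrow> 0"
      "(\<lambda>n. l2_norm (\<lambda>\<xi>. fourier_L1 (F n) \<xi> - g \<xi>)) \<longlonglongrightarrow> 0"
    by (auto simp: has_fourier_L2_def)
  let ?e = "\<lambda>\<xi>. exp (\<i> * of_real \<xi> * of_real a)"
  have e: "cmod (?e \<xi>) = 1" for \<xi>
    by (simp add: norm_exp_eq_Re)
  have eq: "fourier_L1 (\<lambda>t. F n (t + a)) = (\<lambda>\<xi>. ?e \<xi> * fourier_L1 (F n) \<xi>)" for n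
    using fourier_L1_shift by blast
  have sq: "square_integrable (\<lambda>\<xi>. ?e \<xi> * h \<xi>)" if "square_integrable h" for h
  proof (rule square_integrable_cong_AE[OF that])
    note [measurable] = that
    show "(\<lambda>\<xi>. ?e \<xi> * h \<xi>) \<in> borel_measurable borel" by measurable
  qed (simp add: norm_mult e)
  have "l2_norm (\<lambda>t. F n (t + a) - f (t + a)) = l2_norm (\<lambda>t. F n t - f t)"
    and "l2_norm (\<lambda>\<xi>. ?e \<xi> * fourier_L1 (F n) \<xi> - ?e \<xi> * g \<xi>) = l2_norm (\<lambda>\<xi>. fourier_L1 (F n) \<xi> - g \<xi>)" for n
    using l2_norm_shift[of "\<lambda>t. F n t - f t"]
    by (simp_all add: l2_norm_def norm_mult e flip: right_diff_distrib)
  with lim have "(\<lambda>n. l2_norm (\<lambda>t. F n (t + a) - f (t + a))) \<longlonglongrightarrow> 0"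
    "(\<lambda>n. l2_norm (\<lambda>\<xi>. ?e \<xi> * fourier_L1 (F n) \<xi> - ?e \<xi> * g \<xi>)) \<longlonglongrightarrow> 0"
    by simp_all
  moreover have "integrable lborel (\<lambda>t. F n (t + a))" for n
    using lborel_integrable_real_affine[OF F(1), where c=1 and t=a] by (simp add: add.commute)
  ultimately show ?thesis
    unfolding has_fourier_L2_def using f g F
    by (intro conjI exI[of _ "\<lambda>n t. F n (t + a)"]) (auto simp: eq intro: sq square_integrable_shift)
qed

lemma has_fourier_L2_diff:
  assumes "has_fourier_L2 f g" "has_fourier_L2 f' g'"
  shows "has_fourier_L2 (\<lambda>t. f t - f' t) (\<lambda>\<xi>. g \<xi> - g' \<xi>)"
  using has_fourier_L2_add[OF assms(1) has_fourier_L2_cmult[OF assms(2), of "-1"]] by simp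

lemma has_fourier_L2_zero: "has_fourier_L2 (\<lambda>t. 0) (\<lambda>\<xi>. 0)"
  using has_fourier_L2_cmult[OF has_fourier_L2_fourier_L2[OF square_integrable_zero], of 0] by simp

lemma has_fourier_L2_sum:
  assumes "\<And>k. k \<in> S \<Longrightarrow> has_fourier_L2 (f k) (g k)"
  shows "has_fourier_L2 (\<lambda>t. \<Sum>k\<in>S. f k t) (\<lambda>\<xi>. \<Sum>k\<in>S. g k \<xi>)"
  using assms
  by (induction S rule: infinite_finite_induct) (auto intro: has_fourier_L2_add has_fourier_L2_zero)

text \<open>The Fourier multiplier of the combination \<open>\<Sum>k\<in>S. c k * f (t - k)\<close> of translates; hence the minus sign.\<close>

definition trig :: "int set \<Rightarrow> (int \<Rightarrow> complex) \<Rightarrow> real \<Rightarrow> complex" where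
  "trig S c \<xi> = (\<Sum>k\<in>S. c k * exp (- \<i> * of_real \<xi> * of_int k))"

lemma has_fourier_L2_translates:
  assumes "has_fourier_L2 f g"
  shows "has_fourier_L2 (\<lambda>t. \<Sum>k\<in>S. c k * f (t - of_int k)) (\<lambda>\<xi>. trig S c \<xi> * g \<xi>)"
proof -
  have "has_fourier_L2 (\<lambda>t. \<Sum>k\<in>S. c k * f (t + (- of_int k)))
      (\<lambda>\<xi>. \<Sum>k\<in>S. c k * (exp (\<i> * of_real \<xi> * of_real (- of_int k)) * g \<xi>))"
    by (intro has_fourier_L2_sum has_fourier_L2_cmult has_fourier_L2_shift assms)
  then show ?thesis by (simp add: trig_def sum_distrib_right mult.assoc)
qed

lemma Plancherel_L2_nn_integral:
  assumes "has_fourier_L2 f g"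
  shows "(\<integral>\<^sup>+\<xi>. ennreal ((cmod (g \<xi>))\<^sup>2) \<partial>lborel) = ennreal (2 * pi * (l2_norm f)\<^sup>2)"
  using Plancherel_L2[OF assms] ennreal_l2_norm_power2[OF has_fourier_L2_square_integrable(2)[OF assms]]
  by simp

section \<open>Density of trigonometric polynomials\<close>

definition trig_poly :: "(real \<Rightarrow> complex) \<Rightarrow> bool" where
  "trig_poly p \<longleftrightarrow> (\<exists>S c. finite S \<and> p = trig S c)"

lemma trig_poly_monomial: "trig_poly (\<lambda>x. z * exp (- \<i> * of_real x * of_int k))"
  unfolding trig_poly_def
  by (intro exI[of _ "{k}"] exI[of _ "\<lambda>_. z"]) (auto simp: trig_def)

lemma trig_poly_const: "trig_poly (\<lambda>x. z)"
  using trig_poly_monomial[of z 0] by simp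

lemma trig_poly_add:
  assumes "trig_poly p" "trig_poly q"
  shows "trig_poly (\<lambda>x. p x + q x)"
proof -
  from assms obtain S c T d where S: "finite S" "p = trig S c" and T: "finite T" "q = trig T d"
    by (auto simp: trig_poly_def)
  let ?e = "\<lambda>x k. exp (- \<i> * of_real x * of_int k)"
  have "p x + q x = trig (S \<union> T) (\<lambda>k. (if k \<in> S then c k else 0) + (if k \<in> T then d k else 0)) x" for x
  proof -
    have "p x = (\<Sum>k\<in>S \<union> T. (if k \<in> S then c k else 0) * ?e x k)"
      unfolding S trig_def using S(1) T(1) by (intro sum.mono_neutral_cong_left) auto
    moreover have "q x = (\<Sum>k\<in>S \<union> T. (if k \<in> T then d k else 0) * ?e x k)"
      unfolding T trig_def using S(1) T(1) by (intro sum.mono_neutral_cong_left) auto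
    ultimately show ?thesis
      by (simp add: trig_def distrib_right sum.distrib)
  qed
  then show ?thesis
    unfolding trig_poly_def using S(1) T(1) by blast
qed

lemma trig_poly_sum:
  "finite S \<Longrightarrow> (\<And>k. k \<in> S \<Longrightarrow> trig_poly (p k)) \<Longrightarrow> trig_poly (\<lambda>x. \<Sum>k\<in>S. p k x)"
  by (induction S rule: finite_induct) (auto intro: trig_poly_add trig_poly_const)

lemma trig_poly_mult:
  assumes "trig_poly p" "trig_poly q"
  shows "trig_poly (\<lambda>x. p x * q x)"
proof -
  from assms obtain S c T d where S: "finite S" "p = trig S c" and T: "finite T" "q = trig T d"
    by (auto simp: trig_poly_def)
  have "p x * q x = (\<Sum>j\<in>S. \<Sum>k\<in>T. c j * d k * exp (- \<i> * of_real x * of_int (j + k)))" for x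
    unfolding S T trig_def sum_product
    by (intro sum.cong refl) (simp add: distrib_left exp_add[symmetric] mult_exp_exp algebra_simps exp_diff divide_simps)
  then have "(\<lambda>x. p x * q x) = (\<lambda>x. \<Sum>j\<in>S. \<Sum>k\<in>T. c j * d k * exp (- \<i> * of_real x * of_int (j + k)))"
    by blast
  then show ?thesis
    using S(1) T(1) by (simp only:) (intro trig_poly_sum trig_poly_monomial)
qed

text \<open>Coordinate functions restrict to \<open>cos\<close> and \<open>sin\<close> on the circle, so the real polynomial functions
  supplied by the Stone--Weierstrass theorem restrict to trigonometric polynomials.\<close>

lemma trig_poly_real_polynomial_on_circle:
  fixes f :: "complex \<Rightarrow> real"
  assumes "real_polynomial_function f"
  shows "trig_poly (\<lambda>x. of_real (f (cis x)))"
  using assms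
proof induction
  case (linear f)
  have "f (cis x) = cos x * f 1 + sin x * f \<i>" for x
  proof -
    have "f (cis x) = f (cos x *\<^sub>R 1 + sin x *\<^sub>R \<i>)"
      by (intro arg_cong[where f=f]) (simp add: complex_eq_iff)
    also have "\<dots> = cos x * f 1 + sin x * f \<i>"
      using linear by (simp only: bounded_linear.linear linear_add linear_scale real_scaleR_def)
    finally show ?thesis .
  qed
  then have "complex_of_real (f (cis x))
      = (f 1 / 2 + \<i> / 2 * f \<i>) * exp (- \<i> * of_real x * of_int 1)
      + (f 1 / 2 - \<i> / 2 * f \<i>) * exp (- \<i> * of_real x * of_int (-1))" for x
    by (simp add: cis_conv_exp[symmetric] exp_minus_inverse complex_eq_iff exp_eq_polar field_simps)
  then show ?case
    by (simp only:) (intro trig_poly_add trig_poly_monomial)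
qed (auto intro: trig_poly_const trig_poly_add trig_poly_mult)

lemma trig_poly_uniform_approx:
  fixes h :: "real \<Rightarrow> complex"
  assumes h: "continuous_on UNIV h" and "h 0 = h (2 * pi)" and "e > 0"
  obtains p where "trig_poly p" "\<And>x. 0 \<le> x \<Longrightarrow> x < 2 * pi \<Longrightarrow> cmod (h x - p x) < e"
proof -
  \<comment> \<open>A closed loop is a continuous function on the unit circle.\<close>
  let ?loop = "\<lambda>s. h (2 * pi * s)"
  have "homotopic_loops UNIV ?loop ?loop"
    unfolding homotopic_loops_refl using assms(2)
    by (auto simp: path_def pathstart_def pathfinish_def
        intro!: continuous_on_compose2[OF h] continuous_intros)
  then have "homotopic_with_canon (\<lambda>h. True) (sphere 0 1) UNIV
      (?loop \<circ> (\<lambda>z. Arg2pi z / (2 * pi))) (?loop \<circ> (\<lambda>z. Arg2pi z / (2 * pi)))"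
    by (rule homotopic_loops_imp_homotopic_circlemaps)
  then have "continuous_on (sphere 0 1) (?loop \<circ> (\<lambda>z. Arg2pi z / (2 * pi)))"
    by (auto dest: homotopic_with_imp_continuous)
  then have "continuous_on (sphere 0 1) (\<lambda>z. h (Arg2pi z))"
    by (simp add: o_def)
  from Stone_Weierstrass_polynomial_function[OF compact_sphere this \<open>e > 0\<close>]
  obtain p :: "complex \<Rightarrow> complex" where p: "polynomial_function p"
    "\<And>z. z \<in> sphere 0 1 \<Longrightarrow> cmod (h (Arg2pi z) - p z) < e"
    by blast
  have "real_polynomial_function (\<lambda>z. Re (p z))" "real_polynomial_function (\<lambda>z. Im (p z))"
    using p(1) bounded_linear_Re bounded_linear_Im by (auto simp: polynomial_function_def o_def)
  then have "trig_poly (\<lambda>x. of_real (Re (p (cis x))) + \<i> * of_real (Im (p (cis x))))"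
    by (intro trig_poly_add trig_poly_mult trig_poly_const trig_poly_real_polynomial_on_circle)
  then have "trig_poly (\<lambda>x. p (cis x))"
    by (simp add: complex_eq[symmetric])
  moreover have "cmod (h x - p (cis x)) < e" if "0 \<le> x" "x < 2 * pi" for x
  proof -
    have "Arg2pi (cis x) = x"
      using that Arg2pi_unique[of 1 x "cis x"] by (simp add: cis_conv_exp)
    then show ?thesis using p(2)[of "cis x"] by simp
  qed
  ultimately show thesis by (rule that)
qed

text \<open>The continuous approximants need not agree at the two ends of the period. Cutoffs that vanish at both
  ends and increase to \<open>1\<close> in between make them periodic without changing the limit or the bound; uniform
  approximation by trigonometric polynomials then costs at most \<open>1\<close> in the bound.\<close>

lemma bounded_measurable_AE_limit_trig_poly:
  fixes f :: "real \<Rightarrow> complex"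
  assumes "f \<in> borel_measurable borel" and M: "\<And>x. cmod (f x) \<le> M"
  obtains P where "\<And>n::nat. trig_poly (P n)"
    "\<And>n x. 0 \<le> x \<Longrightarrow> x < 2 * pi \<Longrightarrow> cmod (P n x) \<le> M + 1"
    "AE x in lborel. 0 \<le> x \<longrightarrow> x < 2 * pi \<longrightarrow> (\<lambda>n. P n x) \<longlonglongrightarrow> f x"
proof -
  obtain h where h: "\<And>n::nat. continuous_on UNIV (h n)" "\<And>n x. cmod (h n x) \<le> M"
    and lim: "AE x in lborel. (\<lambda>n. h n x) \<longlonglongrightarrow> f x"
    using bounded_measurable_AE_limit_continuous[OF assms] by metis
  define cut :: "nat \<Rightarrow> real \<Rightarrow> complex"
    where "cut n x = of_real (max 0 (min 1 (min (real n * x) (real n * (2 * pi - x)))))" for n x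
  have cut: "continuous_on UNIV (cut n)" for n
    unfolding cut_def by (intro continuous_intros)
  have "\<exists>p. trig_poly p \<and> (\<forall>x. 0 \<le> x \<longrightarrow> x < 2 * pi \<longrightarrow> cmod (h n x * cut n x - p x) < inverse (real (Suc n)))" for n
  proof -
    have "continuous_on UNIV (\<lambda>x. h n x * cut n x)"
      by (intro continuous_intros h cut)
    then show ?thesis
      by (rule trig_poly_uniform_approx[of _ "inverse (real (Suc n))"]) (auto simp: cut_def)
  qed
  then obtain P where P: "\<And>n. trig_poly (P n)"
    and close: "\<And>n x. 0 \<le> x \<Longrightarrow> x < 2 * pi \<Longrightarrow> cmod (h n x * cut n x - P n x) < inverse (real (Suc n))"
    by metis
  show thesis
  proof (rule that[OF P])
    fix n and x :: real assume x: "0 \<le> x" "x < 2 * pi"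
    have "cmod (h n x * cut n x) \<le> M * 1"
      unfolding norm_mult using order_trans[OF norm_ge_zero M]
      by (intro mult_mono h) (auto simp: cut_def)
    moreover have "inverse (real (Suc n)) \<le> 1"
      by (simp add: field_simps)
    ultimately show "cmod (P n x) \<le> M + 1"
      using close[OF x, of n] norm_triangle_ineq2[of "P n x" "h n x * cut n x"]
      by (simp add: norm_minus_commute)
  next
    have "AE x in lborel. x \<noteq> (0::real)"
      by (rule AE_lborel_singleton)
    with lim show "AE x in lborel. 0 \<le> x \<longrightarrow> x < 2 * pi \<longrightarrow> (\<lambda>n. P n x) \<longlonglongrightarrow> f x"
    proof eventually_elim
      fix x assume hx: "(\<lambda>n. h n x) \<longlonglongrightarrow> f x" and "x \<noteq> 0"
      show "0 \<le> x \<longrightarrow> x < 2 * pi \<longrightarrow> (\<lambda>n. P n x) \<longlonglongrightarrow> f x"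
      proof (intro impI)
        assume x: "0 \<le> x" "x < 2 * pi"
        obtain n0 where n0: "1 / min x (2 * pi - x) \<le> real n0"
          using real_arch_simple by blast
        have pos: "min x (2 * pi - x) > 0" using x \<open>x \<noteq> 0\<close> by auto
        have "\<forall>\<^sub>F n in sequentially. cut n x = 1"
        proof (rule eventually_sequentiallyI[of n0])
          fix n assume "n0 \<le> n"
          then have "1 / min x (2 * pi - x) \<le> real n" using n0 by linarith
          then have "1 \<le> real n * min x (2 * pi - x)"
            using pos by (simp add: field_simps)
          then have "1 \<le> min (real n * x) (real n * (2 * pi - x))"
            by (simp add: min_mult_distrib_left)
          then show "cut n x = 1" by (simp add: cut_def)
        qed
        then have "\<forall>\<^sub>F n in sequentially. h n x = h n x * cut n x"
          by eventually_elim simp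
        then have "(\<lambda>n. h n x * cut n x) \<longlonglongrightarrow> f x"
          using hx by (rule Lim_transform_eventually[rotated])
        moreover have "(\<lambda>n. h n x * cut n x - P n x) \<longlonglongrightarrow> 0"
          using close[OF x] by (intro Lim_null_comparison[OF _ LIMSEQ_inverse_real_of_nat])
            (auto intro!: always_eventually less_imp_le)
        ultimately have "(\<lambda>n. h n x * cut n x - (h n x * cut n x - P n x)) \<longlonglongrightarrow> f x - 0"
          by (rule tendsto_diff)
        then show "(\<lambda>n. P n x) \<longlonglongrightarrow> f x" by simp
      qed
    qed
  qed
qed

lemma trig_measurable [measurable]: "trig S c \<in> borel_measurable borel"
proof -
  have "(\<lambda>x. \<Sum>k\<in>S. c k * exp (- \<i> * of_real x * of_int k)) \<in> borel_measurable borel"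
    by measurable
  then show ?thesis by (simp add: trig_def[abs_def])
qed

lemma cmod_diff_power2_le: "(cmod (a - b))\<^sup>2 \<le> 2 * (cmod (a - c))\<^sup>2 + 2 * (cmod (c - b))\<^sup>2"
proof -
  have "cmod (a - b) \<le> cmod (a - c) + cmod (c - b)"
    using norm_triangle_ineq[of "a - c" "c - b"] by simp
  then have "(cmod (a - b))\<^sup>2 \<le> (cmod (a - c) + cmod (c - b))\<^sup>2"
    by (intro power_mono) auto
  also have "\<dots> \<le> 2 * (cmod (a - c))\<^sup>2 + 2 * (cmod (c - b))\<^sup>2"
    using sum_squares_bound[of "cmod (a - c)" "cmod (c - b)"] by (simp add: power2_sum)
  finally show ?thesis .
qed

text \<open>Bounded functions are a.e. limits of uniformly bounded trigonometric polynomials, so dominated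
  convergence applies whatever the integrable weight \<open>w\<close> is; general functions are truncated first.\<close>

lemma trig_dense_weighted:
  fixes f :: "real \<Rightarrow> complex" and w :: "real \<Rightarrow> real"
  assumes [measurable]: "f \<in> borel_measurable borel" "w \<in> borel_measurable borel"
    and w: "(\<integral>\<^sup>+x\<in>{0..<2*pi}. ennreal (w x) \<partial>lborel) < \<infinity>" "\<And>x. 0 \<le> w x"
    and fw: "(\<integral>\<^sup>+x\<in>{0..<2*pi}. ennreal ((cmod (f x))\<^sup>2 * w x) \<partial>lborel) < \<infinity>"
    and "e > 0"
  shows "\<exists>S c. finite S \<and> (\<integral>\<^sup>+x\<in>{0..<2*pi}. ennreal ((cmod (f x - trig S c x))\<^sup>2 * w x) \<partial>lborel) < ennreal e"
proof -
  define \<mu> where "\<mu> = density lborel (\<lambda>x. ennreal (w x) * indicator {0..<2*pi} x)"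
  have [measurable_cong, simp]: "sets \<mu> = sets borel"
    by (simp add: \<mu>_def)
  have \<mu>: "(\<integral>\<^sup>+x. ennreal (u x) \<partial>\<mu>) = (\<integral>\<^sup>+x\<in>{0..<2*pi}. ennreal (u x * w x) \<partial>lborel)"
    if [measurable]: "u \<in> borel_measurable borel" for u
    unfolding \<mu>_def using w(2)
    by (subst nn_integral_density) (auto simp: ennreal_mult'' ac_simps intro!: nn_integral_cong)
  have AE_\<mu>: "AE x in \<mu>. Q x" if "AE x in lborel. 0 \<le> x \<longrightarrow> x < 2 * pi \<longrightarrow> Q x" for Q
    unfolding \<mu>_def using that
    by (subst AE_density) (auto elim!: eventually_mono split: split_indicator_asm)
  have fin: "(\<integral>\<^sup>+x. ennreal c \<partial>\<mu>) < \<infinity>" if "c \<ge> 0" for c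
  proof -
    have "(\<integral>\<^sup>+x. ennreal c \<partial>\<mu>) = ennreal c * (\<integral>\<^sup>+x. ennreal 1 \<partial>\<mu>)"
      by (subst nn_integral_cmult[symmetric]) (auto simp: that)
    moreover have "(\<integral>\<^sup>+x. ennreal 1 \<partial>\<mu>) < \<infinity>"
      using w(1) by (subst \<mu>) auto
    ultimately show ?thesis by (simp only: ennreal_mult_less_top infinity_ennreal_def) simp
  qed
  define T where "T n x = f x * indicator {x. cmod (f x) \<le> real n} x" for n x
  have [measurable]: "T n \<in> borel_measurable borel" for n
    unfolding T_def by measurable
  have "(\<lambda>n. \<integral>\<^sup>+x. ennreal ((cmod (f x - T n x))\<^sup>2) \<partial>\<mu>) \<longlonglongrightarrow> (\<integral>\<^sup>+x. 0 \<partial>\<mu>)"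
  proof (rule nn_integral_dominated_convergence)
    show "(\<integral>\<^sup>+x. ennreal ((cmod (f x))\<^sup>2) \<partial>\<mu>) < \<infinity>"
      using fw by (subst \<mu>) auto
    show "AE x in \<mu>. (\<lambda>n. ennreal ((cmod (f x - T n x))\<^sup>2)) \<longlonglongrightarrow> 0"
    proof (intro AE_I2 tendsto_eventually)
      fix x
      obtain n0 where "cmod (f x) \<le> real n0"
        using real_arch_simple by blast
      then show "\<forall>\<^sub>F n in sequentially. ennreal ((cmod (f x - T n x))\<^sup>2) = 0"
        by (intro eventually_sequentiallyI[of n0]) (auto simp: indicator_def T_def)
    qed
    show "AE x in \<mu>. ennreal ((cmod (f x - T n x))\<^sup>2) \<le> ennreal ((cmod (f x))\<^sup>2)" for n
      by (intro AE_I2 ennreal_leI) (auto simp: T_def indicator_def)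
  qed measurable
  then have "\<forall>\<^sub>F n in sequentially. (\<integral>\<^sup>+x. ennreal ((cmod (f x - T n x))\<^sup>2) \<partial>\<mu>) < ennreal (e/4)"
    using \<open>e > 0\<close> by (intro order_tendstoD(2)) auto
  then obtain n where n: "(\<integral>\<^sup>+x. ennreal ((cmod (f x - T n x))\<^sup>2) \<partial>\<mu>) < ennreal (e/4)"
    using eventually_happens'[OF sequentially_bot] by blast
  have T: "cmod (T n x) \<le> real n" for x
    by (auto simp: T_def indicator_def)
  obtain P where P: "\<And>m::nat. trig_poly (P m)"
    "\<And>m x. 0 \<le> x \<Longrightarrow> x < 2 * pi \<Longrightarrow> cmod (P m x) \<le> real n + 1"
    "AE x in lborel. 0 \<le> x \<longrightarrow> x < 2 * pi \<longrightarrow> (\<lambda>m. P m x) \<longlonglongrightarrow> T n x"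
    using bounded_measurable_AE_limit_trig_poly[of "T n" "real n"] T by auto
  have [measurable]: "P m \<in> borel_measurable borel" for m
    using P(1)[of m] by (auto simp: trig_poly_def)
  have "(\<lambda>m. \<integral>\<^sup>+x. ennreal ((cmod (T n x - P m x))\<^sup>2) \<partial>\<mu>) \<longlonglongrightarrow> (\<integral>\<^sup>+x. 0 \<partial>\<mu>)"
  proof (rule nn_integral_dominated_convergence)
    show "(\<integral>\<^sup>+x. ennreal ((real n + (real n + 1))\<^sup>2) \<partial>\<mu>) < \<infinity>"
      by (rule fin) simp
    show "AE x in \<mu>. (\<lambda>m. ennreal ((cmod (T n x - P m x))\<^sup>2)) \<longlonglongrightarrow> 0"
    proof (rule AE_\<mu>, use P(3) in eventually_elim, intro impI)
      fix x :: real assume "0 \<le> x" "x < 2 * pi" "0 \<le> x \<longrightarrow> x < 2 * pi \<longrightarrow> (\<lambda>m. P m x) \<longlonglongrightarrow> T n x"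
      then have "(\<lambda>m. (cmod (T n x - P m x))\<^sup>2) \<longlonglongrightarrow> (cmod (T n x - T n x))\<^sup>2"
        by (intro tendsto_intros) auto
      then have "(\<lambda>m. ennreal ((cmod (T n x - P m x))\<^sup>2)) \<longlonglongrightarrow> ennreal ((cmod (T n x - T n x))\<^sup>2)"
        by (rule tendsto_ennrealI)
      then show "(\<lambda>m. ennreal ((cmod (T n x - P m x))\<^sup>2)) \<longlonglongrightarrow> 0" by simp
    qed
    show "AE x in \<mu>. ennreal ((cmod (T n x - P m x))\<^sup>2) \<le> ennreal ((real n + (real n + 1))\<^sup>2)" for m
    proof (intro AE_\<mu> AE_I2 impI ennreal_leI power_mono)
      fix x :: real assume "0 \<le> x" "x < 2 * pi"
      then show "cmod (T n x - P m x) \<le> real n + (real n + 1)"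
        using norm_triangle_ineq4[of "T n x" "P m x"] T[of x] P(2)[of x m] by linarith
    qed simp
  qed measurable
  then have "\<forall>\<^sub>F m in sequentially. (\<integral>\<^sup>+x. ennreal ((cmod (T n x - P m x))\<^sup>2) \<partial>\<mu>) < ennreal (e/4)"
    using \<open>e > 0\<close> by (intro order_tendstoD(2)) auto
  then obtain m where m: "(\<integral>\<^sup>+x. ennreal ((cmod (T n x - P m x))\<^sup>2) \<partial>\<mu>) < ennreal (e/4)"
    using eventually_happens'[OF sequentially_bot] by blast
  obtain S c where S: "finite S" "P m = trig S c"
    using P(1)[of m] by (auto simp: trig_poly_def)
  have "(\<integral>\<^sup>+x. ennreal ((cmod (f x - P m x))\<^sup>2) \<partial>\<mu>)
      \<le> (\<integral>\<^sup>+x. 2 * ennreal ((cmod (f x - T n x))\<^sup>2) + 2 * ennreal ((cmod (T n x - P m x))\<^sup>2) \<partial>\<mu>)"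
  proof (intro nn_integral_mono)
    fix x
    have "ennreal ((cmod (f x - P m x))\<^sup>2) \<le> ennreal (2 * (cmod (f x - T n x))\<^sup>2 + 2 * (cmod (T n x - P m x))\<^sup>2)"
      by (intro ennreal_leI cmod_diff_power2_le)
    then show "ennreal ((cmod (f x - P m x))\<^sup>2) \<le> 2 * ennreal ((cmod (f x - T n x))\<^sup>2) + 2 * ennreal ((cmod (T n x - P m x))\<^sup>2)"
      by (simp add: ennreal_mult)
  qed
  also have "\<dots> = 2 * (\<integral>\<^sup>+x. ennreal ((cmod (f x - T n x))\<^sup>2) \<partial>\<mu>) + 2 * (\<integral>\<^sup>+x. ennreal ((cmod (T n x - P m x))\<^sup>2) \<partial>\<mu>)"
    by (simp add: nn_integral_add nn_integral_cmult)
  also have "\<dots> < 2 * ennreal (e/4) + 2 * ennreal (e/4)"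
    using n m by (intro add_strict_mono ennreal_mult_strict_left_mono) auto
  also have "\<dots> = ennreal e"
    using \<open>e > 0\<close> by (simp flip: ennreal_mult' ennreal_plus ennreal_numeral)
  finally have "(\<integral>\<^sup>+x. ennreal ((cmod (f x - P m x))\<^sup>2) \<partial>\<mu>) < ennreal e" .
  then have "(\<integral>\<^sup>+x\<in>{0..<2*pi}. ennreal ((cmod (f x - trig S c x))\<^sup>2 * w x) \<partial>lborel) < ennreal e"
    by (subst (asm) \<mu>) (simp_all add: S(2))
  with S(1) show ?thesis by blast
qed

section \<open>Periodization\<close>

lemma trig_periodic: "trig S c (x + 2 * of_int k * pi) = trig S c x"
proof -
  have "exp (- \<i> * of_real (x + 2 * of_int k * pi) * of_int m) = exp (- \<i> * of_real x * of_int m)" for m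
  proof -
    have "exp (- \<i> * of_real (x + 2 * of_int k * pi) * of_int m)
        = exp (- \<i> * of_real x * of_int m + \<i> * (of_int (- k * m) * (of_real pi * 2)))"
      by (simp add: algebra_simps)
    also have "\<dots> = exp (- \<i> * of_real x * of_int m)"
      by (rule exp_plus_2pin)
    finally show ?thesis .
  qed
  then show ?thesis by (simp add: trig_def)
qed

lemma Parseval_trig:
  assumes "finite S"
  shows "(\<integral>\<^sup>+x\<in>{0..<2*pi}. ennreal ((cmod (trig S c x))\<^sup>2) \<partial>lborel) = ennreal (2 * pi * (\<Sum>k\<in>S. (cmod (c k))\<^sup>2))"
proof -
  let ?I = "{0..2*pi}"
  have e: "has_bochner_integral lborel (\<lambda>x. indicator ?I x *\<^sub>R exp (\<i> * of_real x * of_int m))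
      (if m = 0 then 2 * pi else 0)" for m :: int
  proof (cases "m = 0")
    case True
    have "has_bochner_integral lborel (\<lambda>x. indicator ?I x *\<^sub>R (1::complex)) (measure lborel ?I *\<^sub>R 1)"
      by (intro has_bochner_integral_scaleR_left has_bochner_integral_real_indicator) (auto simp: emeasure_lborel_Icc_eq)
    then show ?thesis using True by (simp add: scaleR_conv_of_real)
  next
    case False
    have "has_bochner_integral lborel (\<lambda>x. indicator ?I x *\<^sub>R exp (\<i> * of_real x * of_int m))
      (exp (\<i> * of_real (2 * pi) * of_int m) / (\<i> * of_int m) - exp (\<i> * of_real 0 * of_int m) / (\<i> * of_int m))"
    proof (rule has_bochner_integral_FTC_Icc)
      fix x :: real
      have "((\<lambda>z. exp (\<i> * z * of_int m) / (\<i> * of_int m)) has_field_derivative exp (\<i> * of_real x * of_int m)) (at (of_real x))"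
        using False by (auto intro!: derivative_eq_intros)
      then show "((\<lambda>x. exp (\<i> * of_real x * of_int m) / (\<i> * of_int m)) has_vector_derivative exp (\<i> * of_real x * of_int m)) (at x within ?I)"
        by (rule has_vector_derivative_real_field)
    qed (auto intro!: continuous_intros)
    moreover have "exp (\<i> * of_real (2 * pi) * of_int m) = 1"
      using exp_integer_2pi[of "of_int m"] by (simp add: ac_simps)
    ultimately show ?thesis using False by simp
  qed
  have sq: "complex_of_real ((cmod (trig S c x))\<^sup>2) = (\<Sum>j\<in>S. \<Sum>k\<in>S. c j * cnj (c k) * exp (\<i> * of_real x * of_int (k - j)))" for x
  proof -
    have "complex_of_real ((cmod (trig S c x))\<^sup>2) = trig S c x * cnj (trig S c x)"
      by (simp add: complex_norm_square[symmetric])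
    also have "\<dots> = (\<Sum>j\<in>S. \<Sum>k\<in>S. c j * cnj (c k) * exp (\<i> * of_real x * of_int (k - j)))"
      unfolding trig_def cnj_sum sum_product
      by (intro sum.cong refl) (simp add: exp_cnj exp_diff exp_minus algebra_simps divide_simps)
    finally show ?thesis .
  qed
  have "has_bochner_integral lborel (\<lambda>x. \<Sum>j\<in>S. \<Sum>k\<in>S. c j * cnj (c k) * (indicator ?I x *\<^sub>R exp (\<i> * of_real x * of_int (k - j))))
      (\<Sum>j\<in>S. \<Sum>k\<in>S. c j * cnj (c k) * (if k - j = 0 then 2 * pi else 0))"
    by (intro has_bochner_integral_sum has_bochner_integral_mult_right e)
  also have "(\<Sum>j\<in>S. \<Sum>k\<in>S. c j * cnj (c k) * (if k - j = 0 then 2 * pi else 0)) = complex_of_real (2 * pi * (\<Sum>k\<in>S. (cmod (c k))\<^sup>2))"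
    using assms
    by (simp add: if_distrib[where f="\<lambda>z. _ * z"] if_distrib[where f=complex_of_real] sum_distrib_left complex_norm_square mult.commute
        cong: if_cong del: of_real_power)
  also have "(\<lambda>x. \<Sum>j\<in>S. \<Sum>k\<in>S. c j * cnj (c k) * (indicator ?I x *\<^sub>R exp (\<i> * of_real x * of_int (k - j))))
      = (\<lambda>x. complex_of_real (indicator ?I x * (cmod (trig S c x))\<^sup>2))"
    unfolding of_real_mult sq by (simp add: sum_distrib_left scaleR_conv_of_real ac_simps)
  finally have "has_bochner_integral lborel (\<lambda>x. Re (complex_of_real (indicator ?I x * (cmod (trig S c x))\<^sup>2)))
      (Re (complex_of_real (2 * pi * (\<Sum>k\<in>S. (cmod (c k))\<^sup>2))))"
    by (rule has_bochner_integral_Re)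
  then have real: "has_bochner_integral lborel (\<lambda>x. indicator ?I x * (cmod (trig S c x))\<^sup>2) (2 * pi * (\<Sum>k\<in>S. (cmod (c k))\<^sup>2))"
    by (simp only: Re_complex_of_real)
  have "(\<integral>\<^sup>+x\<in>{0..<2*pi}. ennreal ((cmod (trig S c x))\<^sup>2) \<partial>lborel) = (\<integral>\<^sup>+x. ennreal (indicator ?I x * (cmod (trig S c x))\<^sup>2) \<partial>lborel)"
  proof (rule nn_integral_cong_AE)
    show "AE x in lborel. ennreal ((cmod (trig S c x))\<^sup>2) * indicator {0..<2*pi} x = ennreal (indicator ?I x * (cmod (trig S c x))\<^sup>2)"
      using AE_lborel_singleton[of "2 * pi"] by eventually_elim (auto simp: indicator_def)
  qed
  also have "\<dots> = ennreal (2 * pi * (\<Sum>k\<in>S. (cmod (c k))\<^sup>2))"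
    using real by (subst nn_integral_eq_integral) (auto simp: has_bochner_integral_iff)
  finally show ?thesis .
qed

text \<open>Where the series diverges, the value is \<open>0\<close>. For square integrable \<open>g\<close> this happens on a null set only,
  and the identification with an \<open>ennreal\<close>-valued integral below respects this convention.\<close>

definition periodization :: "(real \<Rightarrow> complex) \<Rightarrow> real \<Rightarrow> real" where
  "periodization g \<xi> = (\<Sum>\<^sub>\<infinity>k::int. (cmod (g (\<xi> + 2 * of_int k * pi)))\<^sup>2)"

lemma infsum_eq_enn2real_nn_integral:
  fixes f :: "'a \<Rightarrow> real"
  assumes "\<And>x. 0 \<le> f x"
  shows "(\<Sum>\<^sub>\<infinity>x. f x) = enn2real (\<integral>\<^sup>+x. ennreal (f x) \<partial>count_space UNIV)"
proof (cases "f summable_on UNIV")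
  case True
  then have "(\<lambda>x. norm (f x)) summable_on UNIV"
    using assms by simp
  then have "Infinite_Set_Sum.abs_summable_on f UNIV"
    by (simp only: abs_summable_equivalent)
  then have "(\<Sum>\<^sub>\<infinity>x. f x) = (LINT x|count_space UNIV. f x)"
    by (simp add: infsetsum_infsum[symmetric] infsetsum_def)
  also have "\<dots> = enn2real (\<integral>\<^sup>+x. ennreal (f x) \<partial>count_space UNIV)"
    using assms by (intro integral_eq_nn_integral) auto
  finally show ?thesis .
next
  case False
  then have "\<not> (\<lambda>x. norm (f x)) summable_on UNIV"
    using assms by simp
  then have "\<not> integrable (count_space UNIV) f"
    by (simp add: abs_summable_equivalent Infinite_Set_Sum.abs_summable_on_def del: real_norm_def)
  then have "\<not> (\<integral>\<^sup>+x. ennreal (norm (f x)) \<partial>count_space UNIV) < \<infinity>"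
    by (simp add: integrable_iff_bounded)
  then have "(\<integral>\<^sup>+x. ennreal (f x) \<partial>count_space UNIV) = \<infinity>"
    using assms by (simp add: not_less top_unique)
  with False show ?thesis by (simp add: infsum_not_exists)
qed

lemma measurable_nn_integral_count_space_int [measurable]:
  fixes f :: "int \<Rightarrow> real \<Rightarrow> ennreal"
  assumes [measurable]: "\<And>k. f k \<in> borel_measurable borel"
  shows "(\<lambda>x. \<integral>\<^sup>+k. f k x \<partial>count_space UNIV) \<in> borel_measurable borel"
proof -
  have "(\<integral>\<^sup>+k. f k x \<partial>count_space UNIV) = (\<Sum>n. f (from_nat_into UNIV n) x)" for x
  proof -
    have "bij_betw (from_nat_into (UNIV::int set)) UNIV UNIV"
      by (rule bij_betw_from_nat_into) (auto simp: infinite_UNIV_int)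
    from nn_integral_bij_count_space[OF this, of "\<lambda>k. f k x"] show ?thesis
      by (simp add: nn_integral_count_space_nat)
  qed
  then show ?thesis by simp
qed

lemma periodization_eq:
  "periodization g x = enn2real (\<integral>\<^sup>+k. ennreal ((cmod (g (x + 2 * of_int k * pi)))\<^sup>2) \<partial>count_space UNIV)"
  unfolding periodization_def by (rule infsum_eq_enn2real_nn_integral) simp

lemma periodization_nonneg [simp]: "0 \<le> periodization g x"
  by (simp add: periodization_eq)

lemma periodization_measurable [measurable]:
  assumes [measurable]: "g \<in> borel_measurable borel"
  shows "periodization g \<in> borel_measurable borel"
  unfolding periodization_eq[abs_def] by measurable

lemma periodization_periodic: "periodization g (x + 2 * of_int m * pi) = periodization g x"
proof -
  have "bij_betw (\<lambda>k. m + k) (UNIV::int set) UNIV"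
    by (rule bij_betw_byWitness[where f'="\<lambda>k. k - m"]) auto
  from infsum_reindex_bij_betw[OF this, of "\<lambda>k. (cmod (g (x + 2 * of_int k * pi)))\<^sup>2"]
  show ?thesis
    by (simp add: periodization_def algebra_simps)
qed

text \<open>Each real number lies in exactly one translate of \<open>{0..<2*pi}\<close> by a multiple of \<open>2 \<pi>\<close>.\<close>

lemma nn_integral_periodize:
  fixes f :: "real \<Rightarrow> ennreal"
  assumes [measurable]: "f \<in> borel_measurable borel"
  shows "(\<integral>\<^sup>+x. f x \<partial>lborel) = (\<integral>\<^sup>+x\<in>{0..<2*pi}. (\<integral>\<^sup>+k. f (x + 2 * of_int k * pi) \<partial>count_space (UNIV::int set)) \<partial>lborel)"
proof -
  have one: "(\<integral>\<^sup>+k. indicator {0..<2*pi} (x - 2 * of_int k * pi) \<partial>count_space (UNIV::int set)) = (1::ennreal)" for x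
  proof -
    have "indicator {0..<2*pi} (x - 2 * of_int k * pi) = (indicator {\<lfloor>x / (2 * pi)\<rfloor>} k :: ennreal)" for k :: int
    proof -
      have "k = \<lfloor>x / (2 * pi)\<rfloor> \<longleftrightarrow> of_int k \<le> x / (2 * pi) \<and> x / (2 * pi) < of_int k + 1"
        by (metis floor_unique floor_correct of_int_floor_le real_of_int_floor_add_one_gt)
      also have "\<dots> \<longleftrightarrow> x - 2 * of_int k * pi \<in> {0..<2*pi}"
        using pi_gt_zero by (auto simp: field_simps)
      finally show ?thesis by (auto simp: indicator_def)
    qed
    then show ?thesis by simp
  qed
  have "(\<integral>\<^sup>+x. f x \<partial>lborel) = (\<integral>\<^sup>+x. (\<integral>\<^sup>+k. f x * indicator {0..<2*pi} (x - 2 * of_int k * pi) \<partial>count_space (UNIV::int set)) \<partial>lborel)"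
    by (simp add: nn_integral_cmult one)
  also have "\<dots> = (\<integral>\<^sup>+k. (\<integral>\<^sup>+x. f x * indicator {0..<2*pi} (x - 2 * of_int k * pi) \<partial>lborel) \<partial>count_space (UNIV::int set))"
    by (rule nn_integral_count_space_nn_integral) auto
  also have "\<dots> = (\<integral>\<^sup>+k. (\<integral>\<^sup>+x. f (x + 2 * of_int k * pi) * indicator {0..<2*pi} x \<partial>lborel) \<partial>count_space (UNIV::int set))"
  proof (rule nn_integral_cong)
    fix k :: int
    show "(\<integral>\<^sup>+x. f x * indicator {0..<2*pi} (x - 2 * of_int k * pi) \<partial>lborel)
        = (\<integral>\<^sup>+x. f (x + 2 * of_int k * pi) * indicator {0..<2*pi} x \<partial>lborel)"
      using nn_integral_real_affine[of "\<lambda>x. f x * indicator {0..<2*pi} (x - 2 * of_int k * pi)" 1 "2 * of_int k * pi"]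
      by (simp add: add.commute)
  qed
  also have "\<dots> = (\<integral>\<^sup>+x. (\<integral>\<^sup>+k. f (x + 2 * of_int k * pi) * indicator {0..<2*pi} x \<partial>count_space (UNIV::int set)) \<partial>lborel)"
    by (rule nn_integral_count_space_nn_integral[symmetric]) auto
  also have "\<dots> = (\<integral>\<^sup>+x\<in>{0..<2*pi}. (\<integral>\<^sup>+k. f (x + 2 * of_int k * pi) \<partial>count_space (UNIV::int set)) \<partial>lborel)"
    by (simp add: nn_integral_multc)
  finally show ?thesis .
qed

text \<open>The periodic factor \<open>h\<close> comes out of the sum over translates. The case \<open>h = 1\<close> of the folding identity
  bounds the integral of that sum, which is therefore finite almost everywhere and equal to the real-valued
  periodization.\<close>

lemma nn_integral_periodic_mult:
  fixes h :: "real \<Rightarrow> real"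
  assumes g: "square_integrable g" and [measurable]: "h \<in> borel_measurable borel"
    and h: "\<And>x. 0 \<le> h x" "\<And>x k. h (x + 2 * of_int k * pi) = h x"
  shows "(\<integral>\<^sup>+x. ennreal (h x * (cmod (g x))\<^sup>2) \<partial>lborel)
       = (\<integral>\<^sup>+x\<in>{0..<2*pi}. ennreal (h x * periodization g x) \<partial>lborel)"
proof -
  let ?G = "\<lambda>x. \<integral>\<^sup>+k. ennreal ((cmod (g (x + 2 * of_int k * pi)))\<^sup>2) \<partial>count_space (UNIV::int set)"
  have [measurable]: "g \<in> borel_measurable borel"
    using g by (rule square_integrable_measurable)
  have [measurable]: "?G \<in> borel_measurable borel"
    by (rule measurable_nn_integral_count_space_int) measurable
  have "(\<integral>\<^sup>+x. ?G x * indicator {0..<2*pi} x \<partial>lborel) \<noteq> \<infinity>"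
    using g nn_integral_periodize[of "\<lambda>x. ennreal ((cmod (g x))\<^sup>2)"]
    by (auto simp: square_integrable_iff)
  then have "AE x in lborel. ?G x * indicator {0..<2*pi} x \<noteq> \<infinity>"
    by (intro nn_integral_PInf_AE) auto
  then have "AE x in lborel. ennreal (h x) * ?G x * indicator {0..<2*pi} x = ennreal (h x * periodization g x) * indicator {0..<2*pi} x"
  proof eventually_elim
    fix x assume "?G x * indicator {0..<2*pi} x \<noteq> \<infinity>"
    then show "ennreal (h x) * ?G x * indicator {0..<2*pi} x = ennreal (h x * periodization g x) * indicator {0..<2*pi} x"
      using h(1)[of x] by (auto simp: periodization_eq ennreal_mult ennreal_enn2real_if split: split_indicator)
  qed
  note AE = this
  have "(\<integral>\<^sup>+x. ennreal (h x * (cmod (g x))\<^sup>2) \<partial>lborel)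
      = (\<integral>\<^sup>+x\<in>{0..<2*pi}. (\<integral>\<^sup>+k. ennreal (h (x + 2 * of_int k * pi) * (cmod (g (x + 2 * of_int k * pi)))\<^sup>2) \<partial>count_space (UNIV::int set)) \<partial>lborel)"
    by (rule nn_integral_periodize) measurable
  also have "\<dots> = (\<integral>\<^sup>+x. ennreal (h x) * ?G x * indicator {0..<2*pi} x \<partial>lborel)"
    using h by (simp add: ennreal_mult nn_integral_cmult)
  also have "\<dots> = (\<integral>\<^sup>+x\<in>{0..<2*pi}. ennreal (h x * periodization g x) \<partial>lborel)"
    using AE by (rule nn_integral_cong_AE)
  finally show ?thesis .
qed

lemma nn_integral_periodization:
  assumes "square_integrable g"
  shows "(\<integral>\<^sup>+x\<in>{0..<2*pi}. ennreal (periodization g x) \<partial>lborel) = ennreal ((l2_norm g)\<^sup>2)"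
  using nn_integral_periodic_mult[OF assms, of "\<lambda>_. 1"] ennreal_l2_norm_power2[OF assms] by simp

section \<open>Riesz bases and closed spans\<close>

text \<open>Only finite combinations matter below. For these the vector that represents the unconditionally
  convergent series is the finite sum, up to a null set.\<close>

lemma riesz_basis_lower_bound:
  fixes v :: "'i \<Rightarrow> real \<Rightarrow> complex"
  assumes "riesz_basis v V"
  obtains a where "a > 0" "\<And>S c. finite S \<Longrightarrow>
    a * (\<Sum>k\<in>S. (cmod (c k))\<^sup>2) \<le> (l2_norm (\<lambda>t. \<Sum>k\<in>S. c k * v k t))\<^sup>2"
proof -
  from assms obtain a where v: "\<And>k. square_integrable (v k)" and "a > 0"
    and a: "\<And>c. (\<lambda>k. (cmod (c k))\<^sup>2) summable_on UNIV \<Longrightarrow>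
      \<exists>f. l2_has_sum (\<lambda>k t. c k * v k t) f \<and> a * (\<Sum>\<^sub>\<infinity>k. (cmod (c k))\<^sup>2) \<le> (l2_norm f)\<^sup>2"
    unfolding riesz_basis_def by blast
  show thesis
  proof (rule that[OF \<open>a > 0\<close>])
    fix S :: "'i set" and c :: "'i \<Rightarrow> complex" assume S: "finite S"
    define d where "d k = (if k \<in> S then c k else 0)" for k
    have "((\<lambda>k. (cmod (d k))\<^sup>2) has_sum (\<Sum>k\<in>S. (cmod (d k))\<^sup>2)) UNIV"
      using S by (intro has_sum_finite_neutralI[of S]) (auto simp: d_def)
    then have sum: "(\<lambda>k. (cmod (d k))\<^sup>2) summable_on UNIV"
      "(\<Sum>\<^sub>\<infinity>k. (cmod (d k))\<^sup>2) = (\<Sum>k\<in>S. (cmod (c k))\<^sup>2)"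
      by (auto simp: has_sum_imp_summable dest: infsumI simp: d_def)
    obtain f where f: "l2_has_sum (\<lambda>k t. d k * v k t) f" and le: "a * (\<Sum>k\<in>S. (cmod (c k))\<^sup>2) \<le> (l2_norm f)\<^sup>2"
      using a[OF sum(1)] unfolding sum(2) by blast
    let ?s = "\<lambda>t. \<Sum>k\<in>S. c k * v k t"
    have fs: "square_integrable f" and sq: "square_integrable ?s"
      using f v by (auto simp: l2_has_sum_def)
    \<comment> \<open>The partial sums of \<open>f\<close> are constant from \<open>S\<close> on, so \<open>f\<close> is the finite sum.\<close>
    have "((\<lambda>T. l2_norm (\<lambda>t. f t - (\<Sum>k\<in>T. d k * v k t))) \<longlongrightarrow> 0) (finite_subsets_at_top UNIV)"
      using f by (simp add: l2_has_sum_def)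
    moreover have "\<forall>\<^sub>F T in finite_subsets_at_top UNIV. l2_norm (\<lambda>t. f t - (\<Sum>k\<in>T. d k * v k t)) = l2_norm (\<lambda>t. f t - ?s t)"
      unfolding eventually_finite_subsets_at_top
    proof (intro exI[of _ S] conjI allI impI)
      fix T assume T: "finite T \<and> S \<subseteq> T \<and> T \<subseteq> UNIV"
      have "(\<Sum>k\<in>T. d k * v k t) = ?s t" for t
        using T by (intro sum.mono_neutral_cong_right) (auto simp: d_def)
      then show "l2_norm (\<lambda>t. f t - (\<Sum>k\<in>T. d k * v k t)) = l2_norm (\<lambda>t. f t - ?s t)"
        by simp
    qed (use S in auto)
    ultimately have "((\<lambda>T. l2_norm (\<lambda>t. f t - ?s t)) \<longlongrightarrow> 0) (finite_subsets_at_top (UNIV :: 'i set))"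
      by (rule Lim_transform_eventually)
    then have "l2_norm (\<lambda>t. f t - ?s t) = 0"
      by (simp add: tendsto_const_iff)
    then have "l2_norm f = l2_norm ?s"
      using abs_l2_norm_diff_le[OF fs sq] by simp
    with le show "a * (\<Sum>k\<in>S. (cmod (c k))\<^sup>2) \<le> (l2_norm ?s)\<^sup>2" by simp
  qed
qed

lemma l2_closed_span_subset:
  assumes v: "\<And>k. v k \<in> l2_closed_span w" and w: "\<And>k. square_integrable (w k)"
  shows "l2_closed_span v \<subseteq> l2_closed_span w"
proof
  fix f assume f: "f \<in> l2_closed_span v"
  have vs: "square_integrable (v k)" for k
    using v by (simp add: l2_closed_span_def)
  have fs: "square_integrable f"
    using f by (simp add: l2_closed_span_def)
  have "\<exists>S c. finite S \<and> l2_norm (\<lambda>t. f t - (\<Sum>k\<in>S. c k * w k t)) < e" if "e > 0" for e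
  proof -
    have "e/2 > 0" using that by simp
    then obtain S c where S: "finite S" "l2_norm (\<lambda>t. f t - (\<Sum>k\<in>S. c k * v k t)) < e/2"
      using f unfolding l2_closed_span_def by blast
    define \<delta> where "\<delta> = e / (2 * (1 + (\<Sum>k\<in>S. cmod (c k))))"
    have pos: "1 + (\<Sum>k\<in>S. cmod (c k)) > 0"
      using sum_nonneg[of S "\<lambda>k. cmod (c k)"] by simp
    then have "\<delta> > 0" using that by (simp add: \<delta>_def)
    then have "\<forall>k. \<exists>T d. finite T \<and> l2_norm (\<lambda>t. v k t - (\<Sum>l\<in>T. d l * w l t)) < \<delta>"
      using v unfolding l2_closed_span_def by blast
    then obtain T d where T: "\<And>k. finite (T k)"
      and d: "\<And>k. l2_norm (\<lambda>t. v k t - (\<Sum>l\<in>T k. d k l * w l t)) < \<delta>"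
      by metis
    let ?U = "\<Union>k\<in>S. T k"
    let ?b = "\<lambda>l. \<Sum>k\<in>S. c k * (if l \<in> T k then d k l else 0)"
    let ?s = "\<lambda>t. \<Sum>k\<in>S. c k * v k t"
    have U: "finite ?U" using S T by auto
    have eq: "(\<Sum>l\<in>?U. ?b l * w l t) = (\<Sum>k\<in>S. c k * (\<Sum>l\<in>T k. d k l * w l t))" for t
    proof -
      have "(\<Sum>l\<in>?U. ?b l * w l t) = (\<Sum>k\<in>S. c k * (\<Sum>l\<in>?U. (if l \<in> T k then d k l else 0) * w l t))"
        unfolding sum_distrib_right sum_distrib_left by (subst sum.swap) (simp add: mult.assoc)
      also have "\<dots> = (\<Sum>k\<in>S. c k * (\<Sum>l\<in>T k. d k l * w l t))"
      proof (rule sum.cong[OF refl])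
        fix k assume "k \<in> S"
        then have "(\<Sum>l\<in>?U. (if l \<in> T k then d k l else 0) * w l t) = (\<Sum>l\<in>T k. d k l * w l t)"
          using U by (intro sum.mono_neutral_cong_right) auto
        then show "c k * (\<Sum>l\<in>?U. (if l \<in> T k then d k l else 0) * w l t) = c k * (\<Sum>l\<in>T k. d k l * w l t)"
          by simp
      qed
      finally show ?thesis .
    qed
    have "l2_norm (\<lambda>t. ?s t - (\<Sum>l\<in>?U. ?b l * w l t)) = l2_norm (\<lambda>t. \<Sum>k\<in>S. c k * (v k t - (\<Sum>l\<in>T k. d k l * w l t)))"
      by (simp add: eq sum_subtractf right_diff_distrib)
    also have "\<dots> \<le> (\<Sum>k\<in>S. l2_norm (\<lambda>t. c k * (v k t - (\<Sum>l\<in>T k. d k l * w l t))))"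
      using vs w by (intro l2_norm_sum_le) auto
    also have "\<dots> \<le> (\<Sum>k\<in>S. cmod (c k) * \<delta>)"
      unfolding l2_norm_cmult by (intro sum_mono mult_left_mono order_less_imp_le[OF d]) auto
    also have "\<dots> = (\<Sum>k\<in>S. cmod (c k)) * \<delta>"
      by (simp add: sum_distrib_right)
    also have "\<dots> < (1 + (\<Sum>k\<in>S. cmod (c k))) * \<delta>"
      using \<open>\<delta> > 0\<close> by simp
    also have "\<dots> = e/2"
      unfolding \<delta>_def using pos
      by (metis less_irrefl nonzero_mult_divide_mult_cancel_left2 times_divide_eq_right)
    finally have "l2_norm (\<lambda>t. ?s t - (\<Sum>l\<in>?U. ?b l * w l t)) < e/2" .
    moreover have "l2_norm (\<lambda>t. f t - (\<Sum>l\<in>?U. ?b l * w l t)) \<le> l2_norm (\<lambda>t. f t - ?s t) + l2_norm (\<lambda>t. ?s t - (\<Sum>l\<in>?U. ?b l * w l t))"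
      using fs vs w by (intro l2_norm_triangle_diff) auto
    ultimately have "l2_norm (\<lambda>t. f t - (\<Sum>l\<in>?U. ?b l * w l t)) < e"
      using S(2) by simp
    with U show ?thesis
      by (intro exI[of _ ?U] exI[of _ ?b] conjI)
  qed
  with fs show "f \<in> l2_closed_span w"
    by (simp add: l2_closed_span_def)
qed

section \<open>Orthonormalizing the translates\<close>

text \<open>Plancherel's theorem followed by folding onto a period: the Gram form of the translates is the norm of
  \<open>L\<^sup>2\<close> with weight \<open>periodization g\<close>.\<close>

lemma translates_norm:
  assumes "has_fourier_L2 \<phi> g"
  shows "ennreal (2 * pi * (l2_norm (\<lambda>t. \<Sum>k\<in>S. c k * \<phi> (t - of_int k)))\<^sup>2)
    = (\<integral>\<^sup>+x\<in>{0..<2*pi}. ennreal ((cmod (trig S c x))\<^sup>2 * periodization g x) \<partial>lborel)"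
proof -
  have g: "square_integrable g"
    using assms by (rule has_fourier_L2_square_integrable)
  have "ennreal (2 * pi * (l2_norm (\<lambda>t. \<Sum>k\<in>S. c k * \<phi> (t - of_int k)))\<^sup>2)
      = (\<integral>\<^sup>+x. ennreal ((cmod (trig S c x))\<^sup>2 * (cmod (g x))\<^sup>2) \<partial>lborel)"
    using Plancherel_L2_nn_integral[OF has_fourier_L2_translates[OF assms, of c S]]
    by (simp add: norm_mult power_mult_distrib)
  also have "\<dots> = (\<integral>\<^sup>+x\<in>{0..<2*pi}. ennreal ((cmod (trig S c x))\<^sup>2 * periodization g x) \<partial>lborel)"
    by (rule nn_integral_periodic_mult[OF g]) (auto simp: trig_periodic)
  finally show ?thesis .
qed

text \<open>Let \<open>P\<close> approximate the indicator \<open>f\<close> of the zero set \<open>Z\<close> of \<open>G\<close> in \<open>L\<^sup>2(1 + G)\<close>. As \<open>f G = 0\<close>, the weight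
  \<open>G\<close> makes \<open>\<integral> \<bar>P\<bar>\<^sup>2 G\<close>, and hence the norm of the corresponding combination of translates, small. By the lower
  bound and Parseval's identity \<open>\<integral> \<bar>P\<bar>\<^sup>2\<close> is small, and the weight \<open>1\<close> transfers this to \<open>f\<close>. So \<open>Z\<close> is a null set.\<close>

lemma periodization_pos_AE:
  assumes has: "has_fourier_L2 \<phi> g" and "a > 0"
    and lower: "\<And>S c. finite S \<Longrightarrow>
      a * (\<Sum>k\<in>S. (cmod (c k))\<^sup>2) \<le> (l2_norm (\<lambda>t. \<Sum>k\<in>S. c k * \<phi> (t - of_int k)))\<^sup>2"
  shows "AE x in lborel. x \<in> {0..<2*pi} \<longrightarrow> periodization g x > 0"
proof -
  have g: "square_integrable g"
    using has by (rule has_fourier_L2_square_integrable)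
  have [measurable]: "g \<in> borel_measurable borel"
    using g by (rule square_integrable_measurable)
  let ?G = "periodization g"
  let ?Z = "{x. ?G x = 0}"
  let ?f = "\<lambda>x. indicator ?Z x :: complex"
  let ?w = "\<lambda>x. 1 + ?G x"
  have wfin: "(\<integral>\<^sup>+x\<in>{0..<2*pi}. ennreal (?w x) \<partial>lborel) < \<infinity>"
  proof -
    have "(\<integral>\<^sup>+x\<in>{0..<2*pi}. ennreal (?w x) \<partial>lborel) = (\<integral>\<^sup>+x\<in>{0..<2*pi}. 1 \<partial>lborel) + (\<integral>\<^sup>+x\<in>{0..<2*pi}. ennreal (?G x) \<partial>lborel)"
      by (subst nn_integral_add[symmetric]) (auto simp: distrib_right intro!: nn_integral_cong)
    then show ?thesis by (simp add: nn_integral_periodization[OF g] ennreal_add_less_top)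
  qed
  define Y where "Y = (\<integral>\<^sup>+x\<in>{0..<2*pi}. ennreal ((cmod (?f x))\<^sup>2) \<partial>lborel)"
  have "Y \<le> ennreal ((2 + 2 / a) * e)" if "e > 0" for e
  proof -
    have "(\<integral>\<^sup>+x\<in>{0..<2*pi}. ennreal ((cmod (?f x))\<^sup>2 * ?w x) \<partial>lborel) \<le> (\<integral>\<^sup>+x\<in>{0..<2*pi}. ennreal (?w x) \<partial>lborel)"
      by (intro nn_integral_mono mult_right_mono ennreal_leI) (auto simp: indicator_def)
    then have ffin: "(\<integral>\<^sup>+x\<in>{0..<2*pi}. ennreal ((cmod (?f x))\<^sup>2 * ?w x) \<partial>lborel) < \<infinity>"
      using wfin by (rule le_less_trans)
    have "?f \<in> borel_measurable borel" "?w \<in> borel_measurable borel" "\<And>x. 0 \<le> ?w x"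
      by auto
    from trig_dense_weighted[OF this(1,2) wfin this(3) ffin that] obtain S c where S: "finite S"
      and close: "(\<integral>\<^sup>+x\<in>{0..<2*pi}. ennreal ((cmod (?f x - trig S c x))\<^sup>2 * ?w x) \<partial>lborel) < ennreal e"
      by blast
    have "ennreal (2 * pi * (l2_norm (\<lambda>t. \<Sum>k\<in>S. c k * \<phi> (t - of_int k)))\<^sup>2)
        \<le> (\<integral>\<^sup>+x\<in>{0..<2*pi}. ennreal ((cmod (?f x - trig S c x))\<^sup>2 * ?w x) \<partial>lborel)"
      unfolding translates_norm[OF has]
    proof (intro nn_integral_mono mult_right_mono ennreal_leI)
      fix x
      show "(cmod (trig S c x))\<^sup>2 * ?G x \<le> (cmod (?f x - trig S c x))\<^sup>2 * ?w x"
        by (cases "x \<in> ?Z") (auto simp: distrib_left)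
    qed auto
    also note close
    finally have "2 * pi * (l2_norm (\<lambda>t. \<Sum>k\<in>S. c k * \<phi> (t - of_int k)))\<^sup>2 < e"
      by (simp add: ennreal_less_iff)
    moreover have "2 * pi * (a * (\<Sum>k\<in>S. (cmod (c k))\<^sup>2)) \<le> 2 * pi * (l2_norm (\<lambda>t. \<Sum>k\<in>S. c k * \<phi> (t - of_int k)))\<^sup>2"
      using lower[OF S] by (intro mult_left_mono) auto
    ultimately have "2 * pi * (a * (\<Sum>k\<in>S. (cmod (c k))\<^sup>2)) \<le> e"
      by linarith
    then have "2 * pi * (\<Sum>k\<in>S. (cmod (c k))\<^sup>2) \<le> e / a"
      using \<open>a > 0\<close> by (simp add: pos_le_divide_eq ac_simps)
    then have small: "(\<integral>\<^sup>+x\<in>{0..<2*pi}. ennreal ((cmod (trig S c x))\<^sup>2) \<partial>lborel) \<le> ennreal (e / a)"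
      unfolding Parseval_trig[OF S] by (rule ennreal_leI)
    have "Y \<le> (\<integral>\<^sup>+x. 2 * (ennreal ((cmod (?f x - trig S c x))\<^sup>2 * ?w x) * indicator {0..<2*pi} x)
          + 2 * (ennreal ((cmod (trig S c x))\<^sup>2) * indicator {0..<2*pi} x) \<partial>lborel)"
      unfolding Y_def
    proof (intro nn_integral_mono)
      fix x
      have "(cmod (?f x))\<^sup>2 \<le> 2 * (cmod (?f x - trig S c x))\<^sup>2 + 2 * (cmod (trig S c x))\<^sup>2"
        using cmod_diff_power2_le[of "?f x" 0 "trig S c x"] by simp
      also have "\<dots> \<le> 2 * ((cmod (?f x - trig S c x))\<^sup>2 * ?w x) + 2 * (cmod (trig S c x))\<^sup>2"
        by (simp add: distrib_left)
      finally have "ennreal ((cmod (?f x))\<^sup>2) \<le> ennreal (2 * ((cmod (?f x - trig S c x))\<^sup>2 * ?w x) + 2 * (cmod (trig S c x))\<^sup>2)"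
        by (rule ennreal_leI)
      also have "\<dots> = 2 * ennreal ((cmod (?f x - trig S c x))\<^sup>2 * ?w x) + 2 * ennreal ((cmod (trig S c x))\<^sup>2)"
        by (subst ennreal_plus) (auto simp: ennreal_mult')
      finally show "ennreal ((cmod (?f x))\<^sup>2) * indicator {0..<2*pi} x
          \<le> 2 * (ennreal ((cmod (?f x - trig S c x))\<^sup>2 * ?w x) * indicator {0..<2*pi} x)
            + 2 * (ennreal ((cmod (trig S c x))\<^sup>2) * indicator {0..<2*pi} x)"
        by (auto split: split_indicator)
    qed
    also have "\<dots> = 2 * (\<integral>\<^sup>+x\<in>{0..<2*pi}. ennreal ((cmod (?f x - trig S c x))\<^sup>2 * ?w x) \<partial>lborel)
          + 2 * (\<integral>\<^sup>+x\<in>{0..<2*pi}. ennreal ((cmod (trig S c x))\<^sup>2) \<partial>lborel)"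
      by (simp add: nn_integral_add nn_integral_cmult)
    also have "\<dots> \<le> 2 * ennreal e + 2 * ennreal (e / a)"
      using close small by (intro add_mono mult_left_mono) auto
    also have "\<dots> = ennreal (2 * e) + ennreal (2 * (e / a))"
      using ennreal_mult'[of 2] by (simp only: ennreal_numeral zero_le_numeral)
    also have "\<dots> = ennreal ((2 + 2 / a) * e)"
      using that \<open>a > 0\<close> by (subst ennreal_plus[symmetric]) (auto simp: field_simps)
    finally show ?thesis .
  qed
  note Y = this
  have "Y = 0"
  proof (rule ccontr)
    assume "Y \<noteq> 0"
    have "Y < \<infinity>" using Y[of 1] by (auto intro: le_less_trans)
    then obtain y where y: "Y = ennreal y" "y > 0"
      using \<open>Y \<noteq> 0\<close> by (cases Y) (auto simp: less_le)
    have K: "2 + 2 / a > 0" using \<open>a > 0\<close> by (simp add: add_pos_pos)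
    then have "(2 + 2 / a) * (y / (2 * (2 + 2 / a))) = y / 2"
      by (metis nonzero_mult_divide_mult_cancel_left2 less_irrefl times_divide_eq_right)
    with Y[of "y / (2 * (2 + 2 / a))"] y K show False
      by (simp add: ennreal_le_iff)
  qed
  then have "AE x in lborel. ennreal ((cmod (?f x))\<^sup>2) * indicator {0..<2*pi} x = 0"
    unfolding Y_def by (subst (asm) nn_integral_0_iff_AE) auto
  then show ?thesis
  proof eventually_elim
    fix x assume "ennreal ((cmod (?f x))\<^sup>2) * indicator {0..<2*pi} x = 0"
    then show "x \<in> {0..<2*pi} \<longrightarrow> ?G x > 0"
      using periodization_nonneg[of g x] by (auto simp: indicator_def less_le split: if_splits)
  qed
qed

text \<open>Dividing \<open>g\<close> by \<open>sqrt G\<close> cancels the weight \<open>G\<close> that folding produces.\<close>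

lemma nn_integral_normalized:
  fixes T :: "real \<Rightarrow> complex"
  assumes g: "square_integrable g" and [measurable]: "T \<in> borel_measurable borel"
    and T: "\<And>x k. T (x + 2 * of_int k * pi) = T x"
    and pos: "AE x in lborel. x \<in> {0..<2*pi} \<longrightarrow> periodization g x > 0"
  shows "(\<integral>\<^sup>+x. ennreal ((cmod (T x * (g x / of_real (sqrt (periodization g x)))))\<^sup>2) \<partial>lborel)
       = (\<integral>\<^sup>+x\<in>{0..<2*pi}. ennreal ((cmod (T x))\<^sup>2) \<partial>lborel)"
proof -
  have [measurable]: "g \<in> borel_measurable borel"
    using g by (rule square_integrable_measurable)
  have "(\<integral>\<^sup>+x. ennreal ((cmod (T x * (g x / of_real (sqrt (periodization g x)))))\<^sup>2) \<partial>lborel)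
      = (\<integral>\<^sup>+x. ennreal ((cmod (T x))\<^sup>2 / periodization g x * (cmod (g x))\<^sup>2) \<partial>lborel)"
    by (simp add: norm_mult norm_divide power_mult_distrib power_divide)
  also have "\<dots> = (\<integral>\<^sup>+x\<in>{0..<2*pi}. ennreal ((cmod (T x))\<^sup>2 / periodization g x * periodization g x) \<partial>lborel)"
    by (rule nn_integral_periodic_mult[OF g]) (auto simp: T periodization_periodic)
  also have "\<dots> = (\<integral>\<^sup>+x\<in>{0..<2*pi}. ennreal ((cmod (T x))\<^sup>2) \<partial>lborel)"
    using pos by (intro nn_integral_cong_AE, eventually_elim) (auto split: split_indicator)
  finally show ?thesis .
qed

lemma normalized_translates_norm:
  assumes has: "has_fourier_L2 \<psi> F" and g: "square_integrable g"
    and F: "AE x in lborel. F x = g x / of_real (sqrt (periodization g x))"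
    and pos: "AE x in lborel. x \<in> {0..<2*pi} \<longrightarrow> periodization g x > 0"
    and S: "finite S"
  shows "(l2_norm (\<lambda>t. \<Sum>k\<in>S. c k * \<psi> (t - of_int k)))\<^sup>2 = (\<Sum>k\<in>S. (cmod (c k))\<^sup>2)"
proof -
  have "ennreal (2 * pi * (l2_norm (\<lambda>t. \<Sum>k\<in>S. c k * \<psi> (t - of_int k)))\<^sup>2)
      = (\<integral>\<^sup>+x. ennreal ((cmod (trig S c x * F x))\<^sup>2) \<partial>lborel)"
    using Plancherel_L2_nn_integral[OF has_fourier_L2_translates[OF has, of c S]] by simp
  also have "\<dots> = (\<integral>\<^sup>+x. ennreal ((cmod (trig S c x * (g x / of_real (sqrt (periodization g x)))))\<^sup>2) \<partial>lborel)"
    using F by (intro nn_integral_cong_AE, eventually_elim) simp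
  also have "\<dots> = (\<integral>\<^sup>+x\<in>{0..<2*pi}. ennreal ((cmod (trig S c x))\<^sup>2) \<partial>lborel)"
    by (rule nn_integral_normalized[OF g _ _ pos]) (auto simp: trig_periodic)
  also have "\<dots> = ennreal (2 * pi * (\<Sum>k\<in>S. (cmod (c k))\<^sup>2))"
    by (rule Parseval_trig[OF S])
  finally show ?thesis by (simp add: sum_nonneg)
qed

text \<open>Factoring out \<open>g\<close> and folding turns the distance into that between \<open>T / sqrt G\<close> and a trigonometric
  polynomial in \<open>L\<^sup>2\<close> with weight \<open>G\<close>; this target belongs to the space since its square times \<open>G\<close> is
  at most \<open>1\<close>.\<close>

lemma approx_by_translates:
  fixes T :: "real \<Rightarrow> complex"
  assumes g: "square_integrable g" and [measurable]: "T \<in> borel_measurable borel"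
    and T: "\<And>x k. T (x + 2 * of_int k * pi) = T x" "\<And>x. cmod (T x) \<le> 1"
    and "e > 0"
  shows "\<exists>S c. finite S \<and>
    (\<integral>\<^sup>+x. ennreal ((cmod (T x * (g x / of_real (sqrt (periodization g x))) - trig S c x * g x))\<^sup>2) \<partial>lborel) < ennreal e"
proof -
  have [measurable]: "g \<in> borel_measurable borel"
    using g by (rule square_integrable_measurable)
  let ?G = "periodization g"
  let ?f = "\<lambda>x. T x / of_real (sqrt (?G x))"
  have "(\<integral>\<^sup>+x\<in>{0..<2*pi}. ennreal ((cmod (?f x))\<^sup>2 * ?G x) \<partial>lborel) \<le> (\<integral>\<^sup>+x\<in>{0..<2*pi}. 1 \<partial>lborel)"
  proof (intro nn_integral_mono mult_right_mono)
    fix x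
    have "(cmod (?f x))\<^sup>2 * ?G x \<le> (cmod (T x))\<^sup>2"
      by (simp add: norm_divide power_divide)
    also have "\<dots> \<le> 1"
      using T(2)[of x] by (simp add: power_le_one)
    finally show "ennreal ((cmod (?f x))\<^sup>2 * ?G x) \<le> 1"
      by simp
  qed simp
  also have "\<dots> < \<infinity>" by simp
  finally have ffin: "(\<integral>\<^sup>+x\<in>{0..<2*pi}. ennreal ((cmod (?f x))\<^sup>2 * ?G x) \<partial>lborel) < \<infinity>" .
  have "?f \<in> borel_measurable borel" "?G \<in> borel_measurable borel"
    "(\<integral>\<^sup>+x\<in>{0..<2*pi}. ennreal (?G x) \<partial>lborel) < \<infinity>"
    by (auto simp: nn_integral_periodization[OF g])
  from trig_dense_weighted[OF this periodization_nonneg ffin \<open>e > 0\<close>] obtain S c where S: "finite S"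
    and close: "(\<integral>\<^sup>+x\<in>{0..<2*pi}. ennreal ((cmod (?f x - trig S c x))\<^sup>2 * ?G x) \<partial>lborel) < ennreal e"
    by blast
  have "(\<integral>\<^sup>+x. ennreal ((cmod (T x * (g x / of_real (sqrt (?G x))) - trig S c x * g x))\<^sup>2) \<partial>lborel)
      = (\<integral>\<^sup>+x. ennreal ((cmod (?f x - trig S c x))\<^sup>2 * (cmod (g x))\<^sup>2) \<partial>lborel)"
    by (intro nn_integral_cong) (simp flip: norm_mult power_mult_distrib add: left_diff_distrib)
  also have "\<dots> = (\<integral>\<^sup>+x\<in>{0..<2*pi}. ennreal ((cmod (?f x - trig S c x))\<^sup>2 * ?G x) \<partial>lborel)"
    by (rule nn_integral_periodic_mult[OF g]) (auto simp: T periodization_periodic trig_periodic)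
  also note close
  finally show ?thesis using S by blast
qed

text \<open>Here the weight \<open>G\<close> cancels against the normalization, and what remains is the approximation of
  \<open>T sqrt G\<close> in the unweighted \<open>L\<^sup>2\<close> of a period; it is square integrable because \<open>G\<close> is integrable.\<close>

lemma approx_by_normalized_translates:
  fixes T :: "real \<Rightarrow> complex"
  assumes g: "square_integrable g" and [measurable]: "T \<in> borel_measurable borel"
    and T: "\<And>x k. T (x + 2 * of_int k * pi) = T x" "\<And>x. cmod (T x) \<le> 1"
    and pos: "AE x in lborel. x \<in> {0..<2*pi} \<longrightarrow> periodization g x > 0"
    and "e > 0"
  shows "\<exists>S c. finite S \<and>
    (\<integral>\<^sup>+x. ennreal ((cmod (T x * g x - trig S c x * (g x / of_real (sqrt (periodization g x)))))\<^sup>2) \<partial>lborel) < ennreal e"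
proof -
  have [measurable]: "g \<in> borel_measurable borel"
    using g by (rule square_integrable_measurable)
  let ?G = "periodization g"
  let ?f = "\<lambda>x. T x * of_real (sqrt (?G x))"
  have "(\<integral>\<^sup>+x\<in>{0..<2*pi}. ennreal ((cmod (?f x))\<^sup>2 * 1) \<partial>lborel) \<le> (\<integral>\<^sup>+x\<in>{0..<2*pi}. ennreal (?G x) \<partial>lborel)"
  proof (intro nn_integral_mono mult_right_mono ennreal_leI)
    fix x
    have "(cmod (T x))\<^sup>2 * ?G x \<le> 1 * ?G x"
      using T(2)[of x] by (intro mult_right_mono power_le_one) auto
    then show "(cmod (?f x))\<^sup>2 * 1 \<le> ?G x"
      by (simp add: norm_mult power_mult_distrib)
  qed simp
  also have "\<dots> < \<infinity>" by (simp add: nn_integral_periodization[OF g])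
  finally have ffin: "(\<integral>\<^sup>+x\<in>{0..<2*pi}. ennreal ((cmod (?f x))\<^sup>2 * 1) \<partial>lborel) < \<infinity>" .
  have "?f \<in> borel_measurable borel" "(\<lambda>_::real. 1::real) \<in> borel_measurable borel"
    "(\<integral>\<^sup>+x\<in>{0..<2*pi}. ennreal 1 \<partial>lborel) < \<infinity>" "\<And>x::real. 0 \<le> (1::real)"
    by auto
  from trig_dense_weighted[OF this ffin \<open>e > 0\<close>] obtain S c where S: "finite S"
    and close: "(\<integral>\<^sup>+x\<in>{0..<2*pi}. ennreal ((cmod (?f x - trig S c x))\<^sup>2 * 1) \<partial>lborel) < ennreal e"
    by blast
  have "(\<integral>\<^sup>+x. ennreal ((cmod (T x * g x - trig S c x * (g x / of_real (sqrt (?G x)))))\<^sup>2) \<partial>lborel)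
      = (\<integral>\<^sup>+x. ennreal ((cmod (T x - trig S c x / of_real (sqrt (?G x))))\<^sup>2 * (cmod (g x))\<^sup>2) \<partial>lborel)"
    by (intro nn_integral_cong) (simp flip: norm_mult power_mult_distrib add: left_diff_distrib)
  also have "\<dots> = (\<integral>\<^sup>+x\<in>{0..<2*pi}. ennreal ((cmod (T x - trig S c x / of_real (sqrt (?G x))))\<^sup>2 * ?G x) \<partial>lborel)"
    by (rule nn_integral_periodic_mult[OF g]) (auto simp: T periodization_periodic trig_periodic)
  also have "\<dots> = (\<integral>\<^sup>+x\<in>{0..<2*pi}. ennreal ((cmod (?f x - trig S c x))\<^sup>2 * 1) \<partial>lborel)"
    using pos
  proof (intro nn_integral_cong_AE, eventually_elim)
    fix x assume "x \<in> {0..<2*pi} \<longrightarrow> ?G x > 0"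
    moreover have "(cmod (T x - trig S c x / of_real (sqrt (?G x))))\<^sup>2 * ?G x = (cmod (?f x - trig S c x))\<^sup>2" if "?G x > 0"
    proof -
      have "(cmod (T x - trig S c x / of_real (sqrt (?G x))))\<^sup>2 * ?G x
          = (cmod ((T x - trig S c x / of_real (sqrt (?G x))) * of_real (sqrt (?G x))))\<^sup>2"
        by (simp add: norm_mult power_mult_distrib)
      also have "(T x - trig S c x / of_real (sqrt (?G x))) * of_real (sqrt (?G x)) = ?f x - trig S c x"
        using that by (simp add: left_diff_distrib)
      finally show ?thesis .
    qed
    ultimately show "ennreal ((cmod (T x - trig S c x / of_real (sqrt (?G x))))\<^sup>2 * ?G x) * indicator {0..<2*pi} x
        = ennreal ((cmod (?f x - trig S c x))\<^sup>2 * 1) * indicator {0..<2*pi} x"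
      by (auto split: split_indicator)
  qed
  also note close
  finally show ?thesis using S by blast
qed

lemma l2_norm_less_if_fourier:
  assumes "has_fourier_L2 f y" "(\<integral>\<^sup>+x. ennreal ((cmod (y x))\<^sup>2) \<partial>lborel) < ennreal (2 * pi * e\<^sup>2)" "e > 0"
  shows "l2_norm f < e"
proof -
  have "2 * pi * (l2_norm f)\<^sup>2 < 2 * pi * e\<^sup>2"
    using assms(2) unfolding Plancherel_L2_nn_integral[OF assms(1)] by (subst (asm) ennreal_less_iff) auto
  then show ?thesis using \<open>e > 0\<close> by (simp add: power_less_imp_less_base)
qed

lemma cmod_trig_single [simp]: "cmod (trig {j} (\<lambda>_. 1) x) = 1"
  by (simp add: trig_def norm_exp_eq_Re)

text \<open>The two families of translates generate the same closed span. Taking the exponential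
  \<open>exp (- \<i> j \<xi>)\<close> for the periodic factor \<open>T\<close> handles all translates at once.\<close>

lemma translate_approx:
  assumes \<phi>: "has_fourier_L2 \<phi> g" and \<psi>: "has_fourier_L2 \<psi> F"
    and F: "AE x in lborel. F x = g x / of_real (sqrt (periodization g x))"
    and pos: "AE x in lborel. x \<in> {0..<2*pi} \<longrightarrow> periodization g x > 0"
    and "e > 0"
  shows "\<exists>S c. finite S \<and> l2_norm (\<lambda>t. \<psi> (t - of_int j) - (\<Sum>k\<in>S. c k * \<phi> (t - of_int k))) < e"
    and "\<exists>S c. finite S \<and> l2_norm (\<lambda>t. \<phi> (t - of_int j) - (\<Sum>k\<in>S. c k * \<psi> (t - of_int k))) < e"
proof -
  let ?E = "trig {j} (\<lambda>_. 1)"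
  have g: "square_integrable g"
    using \<phi> by (rule has_fourier_L2_square_integrable)
  have "2 * pi * e\<^sup>2 > 0" using \<open>e > 0\<close> by simp
  from approx_by_translates[OF g trig_measurable trig_periodic _ this, of "{j}" "\<lambda>_. 1"]
  obtain S c where S: "finite S"
    and close: "(\<integral>\<^sup>+x. ennreal ((cmod (?E x * (g x / of_real (sqrt (periodization g x))) - trig S c x * g x))\<^sup>2) \<partial>lborel) < ennreal (2 * pi * e\<^sup>2)"
    by auto
  have "has_fourier_L2 (\<lambda>t. (\<Sum>k\<in>{j}. 1 * \<psi> (t - of_int k)) - (\<Sum>k\<in>S. c k * \<phi> (t - of_int k)))
      (\<lambda>x. ?E x * F x - trig S c x * g x)"
    by (intro has_fourier_L2_diff has_fourier_L2_translates[OF \<psi>, of "\<lambda>_. 1"] has_fourier_L2_translates \<phi>)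
  then have 1: "has_fourier_L2 (\<lambda>t. \<psi> (t - of_int j) - (\<Sum>k\<in>S. c k * \<phi> (t - of_int k))) (\<lambda>x. ?E x * F x - trig S c x * g x)"
    by simp
  have "(\<integral>\<^sup>+x. ennreal ((cmod (?E x * F x - trig S c x * g x))\<^sup>2) \<partial>lborel) < ennreal (2 * pi * e\<^sup>2)"
    using close F by (subst nn_integral_cong_AE) (auto elim!: eventually_mono)
  from l2_norm_less_if_fourier[OF 1 this \<open>e > 0\<close>] S
  show "\<exists>S c. finite S \<and> l2_norm (\<lambda>t. \<psi> (t - of_int j) - (\<Sum>k\<in>S. c k * \<phi> (t - of_int k))) < e"
    by blast
next
  let ?E = "trig {j} (\<lambda>_. 1)"
  have g: "square_integrable g"
    using \<phi> by (rule has_fourier_L2_square_integrable)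
  have "2 * pi * e\<^sup>2 > 0" using \<open>e > 0\<close> by simp
  from approx_by_normalized_translates[OF g trig_measurable trig_periodic _ pos this, of "{j}" "\<lambda>_. 1"]
  obtain S c where S: "finite S"
    and close: "(\<integral>\<^sup>+x. ennreal ((cmod (?E x * g x - trig S c x * (g x / of_real (sqrt (periodization g x)))))\<^sup>2) \<partial>lborel) < ennreal (2 * pi * e\<^sup>2)"
    by auto
  have "has_fourier_L2 (\<lambda>t. (\<Sum>k\<in>{j}. 1 * \<phi> (t - of_int k)) - (\<Sum>k\<in>S. c k * \<psi> (t - of_int k)))
      (\<lambda>x. ?E x * g x - trig S c x * F x)"
    by (intro has_fourier_L2_diff has_fourier_L2_translates[OF \<phi>, of "\<lambda>_. 1"] has_fourier_L2_translates \<psi>)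
  then have 1: "has_fourier_L2 (\<lambda>t. \<phi> (t - of_int j) - (\<Sum>k\<in>S. c k * \<psi> (t - of_int k))) (\<lambda>x. ?E x * g x - trig S c x * F x)"
    by simp
  have "(\<integral>\<^sup>+x. ennreal ((cmod (?E x * g x - trig S c x * F x))\<^sup>2) \<partial>lborel) < ennreal (2 * pi * e\<^sup>2)"
    using close F by (subst nn_integral_cong_AE) (auto elim!: eventually_mono)
  from l2_norm_less_if_fourier[OF 1 this \<open>e > 0\<close>] S
  show "\<exists>S c. finite S \<and> l2_norm (\<lambda>t. \<phi> (t - of_int j) - (\<Sum>k\<in>S. c k * \<psi> (t - of_int k))) < e"
    by blast
qed

text \<open>The inverse images \<open>\<Phi> n\<close> are Cauchy by Plancherel's theorem, and the transform of their limit can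
  only be \<open>y\<close>.\<close>

lemma fourier_L2_limit:
  assumes has: "\<And>n::nat. has_fourier_L2 (\<Phi> n) (Y n)" and y: "square_integrable y"
    and lim: "(\<lambda>n. l2_norm (\<lambda>x. Y n x - y x)) \<longlonglongrightarrow> 0"
  obtains \<psi> where "square_integrable \<psi>" "AE x in lborel. fourier_L2 \<psi> x = y x"
proof -
  note sq = has_fourier_L2_square_integrable[OF has]
  have dist: "l2_norm g = sqrt (2 * pi) * l2_norm f" if "has_fourier_L2 f g" for f g
  proof -
    have "sqrt ((l2_norm g)\<^sup>2) = sqrt (2 * pi * (l2_norm f)\<^sup>2)"
      by (simp only: Plancherel_L2[OF that])
    then show ?thesis by (simp add: real_sqrt_mult)
  qed
  obtain \<psi> where \<psi>: "square_integrable \<psi>" "(\<lambda>n. l2_norm (\<lambda>t. \<Phi> n t - \<psi> t)) \<longlonglongrightarrow> 0"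
  proof (rule l2_complete[of \<Phi>])
    fix e :: real assume "e > 0"
    then have "sqrt (2 * pi) * e / 2 > 0" by simp
    then obtain N where N: "\<And>n. n \<ge> N \<Longrightarrow> l2_norm (\<lambda>x. Y n x - y x) < sqrt (2 * pi) * e / 2"
      using LIMSEQ_D[OF lim] by fastforce
    have "l2_norm (\<lambda>t. \<Phi> m t - \<Phi> n t) < e" if "m \<ge> N" "n \<ge> N" for m n
    proof -
      have "sqrt (2 * pi) * l2_norm (\<lambda>t. \<Phi> m t - \<Phi> n t) = l2_norm (\<lambda>x. Y m x - Y n x)"
        by (rule dist[symmetric]) (intro has_fourier_L2_diff has)
      also have "\<dots> < sqrt (2 * pi) * e"
        using l2_norm_triangle_diff[OF sq(2) y sq(2), of m n] N[OF that(1)] N[OF that(2)]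
        by (simp add: l2_norm_minus_commute[of y])
      finally show ?thesis by simp
    qed
    then show "\<exists>N. \<forall>m\<ge>N. \<forall>n\<ge>N. l2_norm (\<lambda>t. \<Phi> m t - \<Phi> n t) < e" by blast
  qed (use sq in auto)
  let ?F = "fourier_L2 \<psi>"
  have F: "has_fourier_L2 \<psi> ?F"
    by (rule has_fourier_L2_fourier_L2[OF \<psi>(1)])
  have Fs: "square_integrable ?F"
    using F by (rule has_fourier_L2_square_integrable)
  have "(\<lambda>n. sqrt (2 * pi) * l2_norm (\<lambda>t. \<Phi> n t - \<psi> t) + l2_norm (\<lambda>x. Y n x - y x)) \<longlonglongrightarrow> sqrt (2 * pi) * 0 + 0"
    by (intro tendsto_intros \<psi> lim)
  moreover have "l2_norm (\<lambda>x. ?F x - y x) \<le> sqrt (2 * pi) * l2_norm (\<lambda>t. \<Phi> n t - \<psi> t) + l2_norm (\<lambda>x. Y n x - y x)" for n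
    using l2_norm_triangle_diff[OF Fs sq(2) y, of n] dist[OF has_fourier_L2_diff[OF has F], of n]
    by (simp add: l2_norm_minus_commute[of ?F])
  ultimately have "l2_norm (\<lambda>x. ?F x - y x) \<le> 0"
    by (intro LIMSEQ_le_const) auto
  then have "l2_norm (\<lambda>x. ?F x - y x) = 0"
    by (simp add: antisym)
  then have "AE x in lborel. ?F x - y x = 0"
    using Fs y by (intro l2_norm_eq_0_AE) auto
  with \<psi>(1) show thesis
    by (intro that) auto
qed

lemma normalized_generator_exists:
  assumes \<phi>: "has_fourier_L2 \<phi> g"
    and pos: "AE x in lborel. x \<in> {0..<2*pi} \<longrightarrow> periodization g x > 0"
  obtains \<psi> where "square_integrable \<psi>"
    "AE x in lborel. fourier_L2 \<psi> x = g x / of_real (sqrt (periodization g x))"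
proof -
  have g: "square_integrable g"
    using \<phi> by (rule has_fourier_L2_square_integrable)
  have [measurable]: "g \<in> borel_measurable borel"
    using g by (rule square_integrable_measurable)
  define y where "y x = g x / of_real (sqrt (periodization g x))" for x
  have [measurable]: "y \<in> borel_measurable borel"
    unfolding y_def by measurable
  have y: "square_integrable y"
    using nn_integral_normalized[OF g _ _ pos, of "\<lambda>_. 1"] by (simp add: square_integrable_iff y_def)
  have "\<exists>S c. finite S \<and> (\<integral>\<^sup>+x. ennreal ((cmod (y x - trig S c x * g x))\<^sup>2) \<partial>lborel) < ennreal ((inverse (real (Suc n)))\<^sup>2)" for n
  proof -
    have "(inverse (real (Suc n)))\<^sup>2 > 0" by simp
    from approx_by_translates[OF g _ _ _ this, of "\<lambda>_. 1"] show ?thesis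
      unfolding y_def mult_1 by (simp del: of_nat_Suc)
  qed
  then obtain S c where "\<And>n. (\<integral>\<^sup>+x. ennreal ((cmod (y x - trig (S n) (c n) x * g x))\<^sup>2) \<partial>lborel) < ennreal ((inverse (real (Suc n)))\<^sup>2)"
    by metis
  note close = this
  define Y where "Y n x = trig (S n) (c n) x * g x" for n x
  have has: "has_fourier_L2 (\<lambda>t. \<Sum>k\<in>S n. c n k * \<phi> (t - of_int k)) (Y n)" for n
    unfolding Y_def by (rule has_fourier_L2_translates[OF \<phi>])
  have "l2_norm (\<lambda>x. Y n x - y x) \<le> inverse (real (Suc n))" for n
  proof -
    have "square_integrable (Y n)"
      using has by (rule has_fourier_L2_square_integrable)
    then have "ennreal ((l2_norm (\<lambda>x. y x - Y n x))\<^sup>2) < ennreal ((inverse (real (Suc n)))\<^sup>2)"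
      using close[of n] y by (subst ennreal_l2_norm_power2) (auto simp: Y_def[symmetric])
    then have "(l2_norm (\<lambda>x. y x - Y n x))\<^sup>2 < (inverse (real (Suc n)))\<^sup>2"
      by (subst (asm) ennreal_less_iff) auto
    then have "l2_norm (\<lambda>x. y x - Y n x) < inverse (real (Suc n))"
      by (rule power_less_imp_less_base) simp
    then show ?thesis by (simp add: l2_norm_minus_commute[of y])
  qed
  then have "(\<lambda>n. l2_norm (\<lambda>x. Y n x - y x)) \<longlonglongrightarrow> 0"
    by (intro Lim_null_comparison[OF _ LIMSEQ_inverse_real_of_nat]) auto
  from fourier_L2_limit[OF has y this] that show thesis
    unfolding y_def by blast
qed

section \<open>Chirp-modulated translates\<close>

definition chirp_modulation :: "real \<Rightarrow> real \<Rightarrow> real \<Rightarrow> real \<Rightarrow> real \<Rightarrow> complex" where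
  "chirp_modulation A B D p t = exp (\<i> * of_real (- (A * t\<^sup>2 + D * p\<^sup>2) / (2 * B)))"

definition chirp_phase :: "real \<Rightarrow> real \<Rightarrow> int \<Rightarrow> complex" where
  "chirp_phase A B k = exp (\<i> * of_real (A * (of_int k)\<^sup>2 / (2 * B)))"

lemma cmod_chirp_modulation [simp]: "cmod (chirp_modulation A B D p t) = 1"
  unfolding chirp_modulation_def by (rule norm_exp_i_times)

lemma cmod_chirp_phase [simp]: "cmod (chirp_phase A B k) = 1"
  unfolding chirp_phase_def by (rule norm_exp_i_times)

lemma chirp_phase_nonzero [simp]: "chirp_phase A B k \<noteq> 0"
  by (simp add: chirp_phase_def)

text \<open>The exponent separates into a part in \<open>t\<close> and a part in \<open>k\<close>. Both factors are unimodular, so the chirps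
  affect neither norms nor, up to unimodular changes of the coefficients, combinations.\<close>

lemma chirp_translate_factor:
  "chirp_translate A B C D p q f k t =
     chirp_modulation A B D p t * (chirp_phase A B k * f (t - of_int k))"
proof -
  have "exp (- (\<i> / of_real (2 * B)) * of_real (A * t\<^sup>2 + D * p\<^sup>2 - A * (of_int k)\<^sup>2))
      = chirp_modulation A B D p t * chirp_phase A B k"
    unfolding chirp_modulation_def chirp_phase_def exp_add[symmetric]
    by (rule arg_cong[where f=exp]) (simp add: field_simps add_divide_distrib diff_divide_distrib)
  then show ?thesis
    unfolding chirp_translate_def by (simp only: ac_simps)
qed

lemma square_integrable_modulate:
  assumes "square_integrable f" "\<And>t. cmod (m t) = 1" "m \<in> borel_measurable borel"
  shows "square_integrable (\<lambda>t. m t * f t)"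
proof (rule square_integrable_cong_AE[OF assms(1)])
  have "f \<in> borel_measurable borel"
    using assms(1) by (rule square_integrable_measurable)
  then show "(\<lambda>t. m t * f t) \<in> borel_measurable borel"
    using assms(3) by measurable
qed (simp add: norm_mult assms)

lemma l2_norm_modulate:
  assumes "\<And>t. cmod (m t) = 1"
  shows "l2_norm (\<lambda>t. m t * f t) = l2_norm f"
  by (simp add: l2_norm_def norm_mult assms)

lemma square_integrable_chirp_translate:
  assumes "square_integrable f"
  shows "square_integrable (chirp_translate A B C D p q f k)"
proof -
  have "square_integrable (\<lambda>t. f (t - of_int k))"
    using square_integrable_shift[OF assms, of "- of_int k"] by simp
  moreover have "(\<lambda>t. chirp_modulation A B D p t) \<in> borel_measurable borel"
    unfolding chirp_modulation_def by measurable
  ultimately have "square_integrable (\<lambda>t. chirp_modulation A B D p t * (chirp_phase A B k * f (t - of_int k)))"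
    by (intro square_integrable_modulate square_integrable_cmult) auto
  then show ?thesis
    by (simp only: chirp_translate_factor[abs_def])
qed

lemma chirp_translate_in_closed_span:
  assumes f: "square_integrable f"
    and approx: "\<And>e. e > 0 \<Longrightarrow> \<exists>S c. finite S \<and> l2_norm (\<lambda>t. f (t - of_int j) - (\<Sum>k\<in>S. c k * h (t - of_int k))) < e"
  shows "chirp_translate A B C D p q f j \<in> l2_closed_span (chirp_translate A B C D p q h)"
proof -
  let ?m = "chirp_modulation A B D p" and ?u = "chirp_phase A B"
  have "\<exists>S c. finite S \<and> l2_norm (\<lambda>t. chirp_translate A B C D p q f j t - (\<Sum>k\<in>S. c k * chirp_translate A B C D p q h k t)) < e"
    if "e > 0" for e
  proof -
    obtain S c where S: "finite S" and c: "l2_norm (\<lambda>t. f (t - of_int j) - (\<Sum>k\<in>S. c k * h (t - of_int k))) < e"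
      using approx[OF \<open>e > 0\<close>] by blast
    have "(?u j * c k / ?u k) * chirp_translate A B C D p q h k t = ?m t * (?u j * (c k * h (t - of_int k)))" for k t
      by (simp add: chirp_translate_factor)
    then have "chirp_translate A B C D p q f j t - (\<Sum>k\<in>S. (?u j * c k / ?u k) * chirp_translate A B C D p q h k t)
        = ?m t * (?u j * (f (t - of_int j) - (\<Sum>k\<in>S. c k * h (t - of_int k))))" for t
      by (simp only: chirp_translate_factor[of A B C D p q f] right_diff_distrib sum_distrib_left)
    then have "l2_norm (\<lambda>t. chirp_translate A B C D p q f j t - (\<Sum>k\<in>S. (?u j * c k / ?u k) * chirp_translate A B C D p q h k t)) < e"
      using c by (simp add: l2_norm_modulate l2_norm_cmult)
    with S show ?thesis by (intro exI conjI)
  qed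
  with square_integrable_chirp_translate[OF f] show ?thesis
    by (simp add: l2_closed_span_def)
qed

lemma l2_norm_chirp_sum:
  "l2_norm (\<lambda>t. \<Sum>k\<in>S. c k * chirp_translate A B C D p q f k t)
     = l2_norm (\<lambda>t. \<Sum>k\<in>S. (c k * chirp_phase A B k) * f (t - of_int k))"
proof -
  have "(\<Sum>k\<in>S. c k * chirp_translate A B C D p q f k t)
      = chirp_modulation A B D p t * (\<Sum>k\<in>S. (c k * chirp_phase A B k) * f (t - of_int k))" for t
    by (simp add: chirp_translate_factor sum_distrib_left ac_simps)
  then show ?thesis by (simp add: l2_norm_modulate)
qed

lemma orthonormal_if_Pythagoras:
  assumes v: "\<And>k. square_integrable (v k)"
    and norm: "\<And>S c. finite S \<Longrightarrow> (l2_norm (\<lambda>t. \<Sum>k\<in>S. c k * v k t))\<^sup>2 = (\<Sum>k\<in>S. (cmod (c k))\<^sup>2)"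
  shows "l2_inner (v j) (v k) = (if j = k then 1 else 0)"
proof -
  have one: "(l2_norm (v i))\<^sup>2 = 1" for i
    using norm[of "{i}" "\<lambda>_. 1"] by simp
  then have one': "l2_norm (v i) = 1" for i
    by (metis l2_norm_nonneg abs_of_nonneg real_sqrt_abs real_sqrt_one)
  show ?thesis
  proof (cases "j = k")
    case True
    then show ?thesis using one[of k] by (simp add: l2_inner_self del: of_real_power)
  next
    case False
    have "(l2_norm (\<lambda>t. v j t + c * v k t))\<^sup>2 = 2" if "cmod c = 1" for c
      using norm[of "{j, k}" "\<lambda>i. if i = j then 1 else c"] False that by simp
    then show ?thesis
      using False l2_inner_eq_0_if_Pythagoras[OF v v one' one'] by simp
  qed
qed

theorem theorem4p3:
  fixes A B C D p q :: real and \<phi> :: "real \<Rightarrow> complex"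
  defines "V\<^sub>0 \<equiv> l2_closed_span (chirp_translate A B C D p q \<phi>)"
    and "spectrum_eq \<equiv> \<lambda>\<psi>. square_integrable \<psi> \<and>
      (AE \<omega> in lborel. fourier_L2 \<psi> ((\<omega> - p) / B) =
         fourier_L2 \<phi> ((\<omega> - p) / B) /
         of_real (sqrt (\<Sum>\<^sub>\<infinity>k::int. (cmod (fourier_L2 \<phi> ((\<omega> - p) / B + 2 * of_int k * pi)))\<^sup>2)))"
  assumes "A * D - B * C = 1"
    and "B \<noteq> 0"
    and "square_integrable \<phi>"
    and "riesz_basis (chirp_translate A B C D p q \<phi>) V\<^sub>0"
  shows "(\<exists>\<psi>. spectrum_eq \<psi>) \<and>
    (\<forall>\<psi>. spectrum_eq \<psi> \<longrightarrow> orthonormal_basis (chirp_translate A B C D p q \<psi>) V\<^sub>0)"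
proof -
  let ?W = "chirp_translate A B C D p q"
  let ?g = "fourier_L2 \<phi>"
  let ?y = "\<lambda>x. ?g x / of_real (sqrt (periodization ?g x))"
  have has\<phi>: "has_fourier_L2 \<phi> ?g"
    using assms(5) by (rule has_fourier_L2_fourier_L2)
  have g: "square_integrable ?g"
    using has\<phi> by (rule has_fourier_L2_square_integrable)
  have [measurable]: "?g \<in> borel_measurable borel"
    using g by (rule square_integrable_measurable)
  \<comment> \<open>The affine substitution \<open>\<omega> = p + B \<xi>\<close> preserves null sets.\<close>
  have spectrum: "spectrum_eq \<psi> \<longleftrightarrow> square_integrable \<psi> \<and> (AE x in lborel. fourier_L2 \<psi> x = ?y x)" for \<psi>
  proof (cases "square_integrable \<psi>")
    case True
    then have "fourier_L2 \<psi> \<in> borel_measurable borel"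
      using has_fourier_L2_fourier_L2 has_fourier_L2_square_integrable(2) square_integrable_measurable by blast
    note [measurable] = this
    have eq: "spectrum_eq \<psi> \<longleftrightarrow> (AE \<omega> in lborel. fourier_L2 \<psi> ((\<omega> - p) / B) = ?y ((\<omega> - p) / B))"
      using True by (simp add: spectrum_eq_def periodization_def)
    show ?thesis
    proof
      assume "spectrum_eq \<psi>"
      then have *: "AE \<omega> in lborel. fourier_L2 \<psi> ((\<omega> - p) / B) = ?y ((\<omega> - p) / B)"
        by (simp only: eq)
      have "AE x in lborel. fourier_L2 \<psi> ((p + B * x - p) / B) = ?y ((p + B * x - p) / B)"
        by (rule AE_borel_affine[OF \<open>B \<noteq> 0\<close> _ *]) measurable
      then show "square_integrable \<psi> \<and> (AE x in lborel. fourier_L2 \<psi> x = ?y x)"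
        using True \<open>B \<noteq> 0\<close> by simp
    next
      assume "square_integrable \<psi> \<and> (AE x in lborel. fourier_L2 \<psi> x = ?y x)"
      then have *: "AE x in lborel. fourier_L2 \<psi> x = ?y x" ..
      have "AE \<omega> in lborel. fourier_L2 \<psi> (- p / B + 1 / B * \<omega>) = ?y (- p / B + 1 / B * \<omega>)"
        by (rule AE_borel_affine[OF _ _ *]) (use \<open>B \<noteq> 0\<close> in \<open>simp, measurable\<close>)
      moreover have "- p / B + 1 / B * \<omega> = (\<omega> - p) / B" for \<omega>
        by (simp add: diff_divide_distrib)
      ultimately show "spectrum_eq \<psi>"
        by (simp only: eq)
    qed
  qed (simp add: spectrum_eq_def)
  obtain a where "a > 0" and a: "\<And>S c. finite S \<Longrightarrow>
      a * (\<Sum>k\<in>S. (cmod (c k))\<^sup>2) \<le> (l2_norm (\<lambda>t. \<Sum>k\<in>S. c k * ?W \<phi> k t))\<^sup>2"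
    by (rule riesz_basis_lower_bound[OF assms(6)]) blast
  have "a * (\<Sum>k\<in>S. (cmod (c k))\<^sup>2) \<le> (l2_norm (\<lambda>t. \<Sum>k\<in>S. c k * \<phi> (t - of_int k)))\<^sup>2" if "finite S" for S c
    using a[OF that, of "\<lambda>k. c k / chirp_phase A B k"] unfolding l2_norm_chirp_sum
    by (simp add: norm_divide)
  then have pos: "AE x in lborel. x \<in> {0..<2*pi} \<longrightarrow> periodization ?g x > 0"
    by (rule periodization_pos_AE[OF has\<phi> \<open>a > 0\<close>])
  have "\<exists>\<psi>. spectrum_eq \<psi>"
    unfolding spectrum by (rule normalized_generator_exists[OF has\<phi> pos]) blast
  moreover have "orthonormal_basis (?W \<psi>) V\<^sub>0" if "spectrum_eq \<psi>" for \<psi>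
  proof -
    have \<psi>: "square_integrable \<psi>" and F: "AE x in lborel. fourier_L2 \<psi> x = ?y x"
      using that unfolding spectrum by auto
    have has\<psi>: "has_fourier_L2 \<psi> (fourier_L2 \<psi>)"
      using \<psi> by (rule has_fourier_L2_fourier_L2)
    have sq\<phi>: "square_integrable (?W \<phi> k)" and sq\<psi>: "square_integrable (?W \<psi> k)" for k
      using assms(5) \<psi> by (auto intro: square_integrable_chirp_translate)
    have "(l2_norm (\<lambda>t. \<Sum>k\<in>S. c k * ?W \<psi> k t))\<^sup>2 = (\<Sum>k\<in>S. (cmod (c k))\<^sup>2)" if "finite S" for S c
      unfolding l2_norm_chirp_sum
      using normalized_translates_norm[OF has\<psi> g F pos that, of "\<lambda>k. c k * chirp_phase A B k"]
      by (simp add: norm_mult)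
    then have "l2_inner (?W \<psi> j) (?W \<psi> k) = (if j = k then 1 else 0)" for j k
      by (rule orthonormal_if_Pythagoras[OF sq\<psi>])
    moreover have "l2_closed_span (?W \<psi>) = V\<^sub>0"
      unfolding V\<^sub>0_def
      using translate_approx[OF has\<phi> has\<psi> F pos] assms(5) \<psi> sq\<phi> sq\<psi>
      by (intro equalityI l2_closed_span_subset chirp_translate_in_closed_span) auto
    ultimately show ?thesis
      using sq\<psi> by (simp add: orthonormal_basis_def)
  qed
  ultimately show ?thesis by blast
qed

end
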